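(* Let $\Gamma$ be a countable inner ultrahomogeneous group such that $\operatorname{Age}(\Gamma)$ is closed under $\times$ or under $\times\mathbf Z$. Then $\Gamma$ has ample generic automorphisms.
   Context: Conjugation is written $g^h=h^{-1}gh$. A finite partial automorphism of a group $G$ is an isomorphism between two finitely generated subgroups of $G$. A group $\Gamma$ is inner ultrahomogeneous if for every finite partial automorphism $p$ of $\Gamma$ there is some $g\in\Gamma$ such that $a^g=p(a)$ for all $a\in\operatorname{dom}p$. $\operatorname{Age}(\Gamma)$ is the class of finitely generated groups embeddable in $\Gamma$; it is closed under $\times$ if $A,B\in\operatorname{Age}(\Gamma)$ implies $A\times B\in\operatorname{Age}(\Gamma)$, and closed under $\times\mathbf Z$ if $A\in\operatorname{Age}(\Gamma)$ implies $A\times\mathbf Z\in\operatorname{Age}(\Gamma)$. For a topological group $G$, an $n$-tuple $\bar g\in G^n$ is generic if its orbit under diagonal conjugation by $G$ is comeagre in $G^n$; $G$ has ample generics if it has a generic $n$-tuple for every $n$. A structure has ample generic automorphisms if $\operatorname{Aut}$ of it, with the topology of pointwise convergence (basic neighbourhoods of the identity are stabilisers of finite sets), has ample generics. *)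

theory Defs
  imports "HOL-Analysis.Analysis" "HOL-Algebra.Bij" "HOL-Algebra.Elementary_Groups"
begin

section \<open>Inner ultrahomogeneous groups and ages\<close>

definition fin_gen_subgroup :: "'a set \<Rightarrow> ('a, 'b) monoid_scheme \<Rightarrow> bool" where
  "fin_gen_subgroup A G \<longleftrightarrow> (\<exists>S. finite S \<and> S \<subseteq> carrier G \<and> A = generate G S)"

definition fin_gen_group :: "('a, 'b) monoid_scheme \<Rightarrow> bool" where
  "fin_gen_group G \<longleftrightarrow> group G \<and> fin_gen_subgroup (carrier G) G"

text \<open>
  \<open>finite_partial_automorphism G A p\<close>: the total function \<open>p\<close>, restricted to \<open>A\<close>, is a
  finite partial automorphism with domain \<open>A\<close>.
\<close>

definition finite_partial_automorphism ::
    "('a, 'b) monoid_scheme \<Rightarrow> 'a set \<Rightarrow> ('a \<Rightarrow> 'a) \<Rightarrow> bool" where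
  "finite_partial_automorphism G A p \<longleftrightarrow>
     fin_gen_subgroup A G \<and>
     (\<exists>B. fin_gen_subgroup B G \<and> p \<in> iso (G\<lparr>carrier := A\<rparr>) (G\<lparr>carrier := B\<rparr>))"

definition conj_by :: "('a, 'b) monoid_scheme \<Rightarrow> 'a \<Rightarrow> 'a \<Rightarrow> 'a" where
  "conj_by G g h = inv\<^bsub>G\<^esub> h \<otimes>\<^bsub>G\<^esub> g \<otimes>\<^bsub>G\<^esub> h"

definition inner_ultrahomogeneous :: "('a, 'b) monoid_scheme \<Rightarrow> bool" where
  "inner_ultrahomogeneous G \<longleftrightarrow>
     (\<forall>A p. finite_partial_automorphism G A p \<longrightarrow>
        (\<exists>g \<in> carrier G. \<forall>a \<in> A. conj_by G a g = p a))"

definition in_Age :: "('b, 'c) monoid_scheme \<Rightarrow> ('a, 'd) monoid_scheme \<Rightarrow> bool" where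
  "in_Age A G \<longleftrightarrow> fin_gen_group A \<and> mon A G \<noteq> {}"

text \<open>
  In the two closure properties the members of the age range over groups with elements in the
  type of \<open>G\<close>. This is no restriction: every member of the age is isomorphic to a subgroup
  of \<open>G\<close>, and membership of the products is invariant under isomorphism of the factors.
\<close>

definition Age_closed_times :: "'a monoid \<Rightarrow> bool" where
  "Age_closed_times G \<longleftrightarrow>
     (\<forall>(A :: 'a monoid) (B :: 'a monoid). in_Age A G \<and> in_Age B G \<longrightarrow> in_Age (A \<times>\<times> B) G)"

definition Age_closed_times_Z :: "'a monoid \<Rightarrow> bool" where
  "Age_closed_times_Z G \<longleftrightarrow>
     (\<forall>A :: 'a monoid. in_Age A G \<longrightarrow> in_Age (A \<times>\<times> integer_group) G)"

section \<open>Ample generics\<close>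

definition nowhere_dense_in :: "'a topology \<Rightarrow> 'a set \<Rightarrow> bool" where
  "nowhere_dense_in T S \<longleftrightarrow> S \<subseteq> topspace T \<and> T interior_of (T closure_of S) = {}"

definition meagre_in :: "'a topology \<Rightarrow> 'a set \<Rightarrow> bool" where
  "meagre_in T S \<longleftrightarrow>
     (\<exists>\<N>. countable \<N> \<and> (\<forall>N \<in> \<N>. nowhere_dense_in T N) \<and> S = \<Union>\<N>)"

definition comeagre_in :: "'a topology \<Rightarrow> 'a set \<Rightarrow> bool" where
  "comeagre_in T S \<longleftrightarrow> S \<subseteq> topspace T \<and> meagre_in T (topspace T - S)"

text \<open>
  The topological group is given by a group \<open>G\<close> and a topology \<open>T\<close> on its carrier. Elements
  of the \<open>n\<close>-th power are the extensional functions on \<open>{..<n}\<close>.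
\<close>

definition diagonal_conj_orbit ::
    "('a, 'b) monoid_scheme \<Rightarrow> nat \<Rightarrow> (nat \<Rightarrow> 'a) \<Rightarrow> (nat \<Rightarrow> 'a) set" where
  "diagonal_conj_orbit G n g = (\<lambda>h. \<lambda>i\<in>{..<n}. conj_by G (g i) h) ` carrier G"

definition generic_tuple ::
    "('a, 'b) monoid_scheme \<Rightarrow> 'a topology \<Rightarrow> nat \<Rightarrow> (nat \<Rightarrow> 'a) \<Rightarrow> bool" where
  "generic_tuple G T n g \<longleftrightarrow>
     g \<in> {..<n} \<rightarrow>\<^sub>E carrier G \<and>
     comeagre_in (product_topology (\<lambda>_. T) {..<n}) (diagonal_conj_orbit G n g)"

definition ample_generics :: "('a, 'b) monoid_scheme \<Rightarrow> 'a topology \<Rightarrow> bool" where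
  "ample_generics G T \<longleftrightarrow> (\<forall>n. \<exists>g. generic_tuple G T n g)"

text \<open>
  The topology of pointwise convergence. Elements of \<^term>\<open>auto G\<close> are extensional, so
  \<^term>\<open>auto G\<close> is contained in the topspace of the product.
\<close>

definition pointwise_topology :: "('a, 'b) monoid_scheme \<Rightarrow> ('a \<Rightarrow> 'a) topology" where
  "pointwise_topology G =
     subtopology (product_topology (\<lambda>_. discrete_topology (carrier G)) (carrier G)) (auto G)"

definition ample_generic_automorphisms :: "('a, 'b) monoid_scheme \<Rightarrow> bool" where
  "ample_generic_automorphisms G \<longleftrightarrow> ample_generics (AutoGroup G) (pointwise_topology G)"

lemma auto_subset_PiE: "auto G \<subseteq> carrier G \<rightarrow>\<^sub>E carrier G"
  by (auto simp: auto_def Bij_def bij_betw_def PiE_def)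

lemma topspace_pointwise_topology: "topspace (pointwise_topology G) = carrier (AutoGroup G)"
  using auto_subset_PiE[of G] by (auto simp: pointwise_topology_def AutoGroup_def)

lemma openin_pointwise_topology_iff:
  "openin (pointwise_topology G) U \<longleftrightarrow>
     U \<subseteq> auto G \<and>
     (\<forall>f\<in>U. \<exists>F. finite F \<and> F \<subseteq> carrier G \<and> {g \<in> auto G. \<forall>x\<in>F. g x = f x} \<subseteq> U)"
    (is "?L \<longleftrightarrow> ?R")
proof
  assume ?L
  then obtain V where
    V: "openin (product_topology (\<lambda>_. discrete_topology (carrier G)) (carrier G)) V"
    and U: "U = V \<inter> auto G"
    by (auto simp: pointwise_topology_def openin_subtopology)
  have "\<exists>F. finite F \<and> F \<subseteq> carrier G \<and> {g \<in> auto G. \<forall>x\<in>F. g x = f x} \<subseteq> U" if "f \<in> U" for f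
  proof -
    have "f \<in> V" using that U by auto
    then obtain W where W: "finite {i \<in> carrier G. W i \<noteq> carrier G}"
      "f \<in> Pi\<^sub>E (carrier G) W" "Pi\<^sub>E (carrier G) W \<subseteq> V"
      using V unfolding openin_product_topology_alt by auto
    have "g \<in> U" if g: "g \<in> auto G"
      and eq: "\<forall>x\<in>{i \<in> carrier G. W i \<noteq> carrier G}. g x = f x" for g
    proof -
      have "g \<in> carrier G \<rightarrow>\<^sub>E carrier G" using g auto_subset_PiE by blast
      moreover have "g i \<in> W i" if "i \<in> carrier G" for i
        using that eq W(2) \<open>g \<in> carrier G \<rightarrow>\<^sub>E carrier G\<close> by (cases "W i = carrier G") auto
      ultimately have "g \<in> Pi\<^sub>E (carrier G) W" by (auto simp: PiE_def)
      with W(3) g U show ?thesis by blast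
    qed
    with W(1) show ?thesis
      by (intro exI[of _ "{i \<in> carrier G. W i \<noteq> carrier G}"]) auto
  qed
  with U show ?R by auto
next
  assume R: ?R
  have "\<exists>T. openin (pointwise_topology G) T \<and> f \<in> T \<and> T \<subseteq> U" if f: "f \<in> U" for f
  proof -
    obtain F where F: "finite F" "F \<subseteq> carrier G" "{g \<in> auto G. \<forall>x\<in>F. g x = f x} \<subseteq> U"
      using R f by blast
    define W where "W = (\<lambda>i. if i \<in> F then {f i} else carrier G)"
    have fa: "f \<in> auto G" using R f by blast
    then have fE: "f \<in> carrier G \<rightarrow>\<^sub>E carrier G" using auto_subset_PiE by blast
    have "finite {i. W i \<noteq> topspace (discrete_topology (carrier G))}"
      by (rule finite_subset[OF _ F(1)]) (auto simp: W_def)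
    moreover have "openin (discrete_topology (carrier G)) (W i)" for i
      using fE F(2) by (auto simp: W_def)
    ultimately have "openin (product_topology (\<lambda>_. discrete_topology (carrier G)) (carrier G))
        (Pi\<^sub>E (carrier G) W)"
      by (intro product_topology_basis)
    then have "openin (pointwise_topology G) (Pi\<^sub>E (carrier G) W \<inter> auto G)"
      by (auto simp: pointwise_topology_def openin_subtopology)
    moreover have "f \<in> Pi\<^sub>E (carrier G) W \<inter> auto G"
      using fE fa by (auto simp: W_def PiE_iff)
    moreover have "Pi\<^sub>E (carrier G) W \<inter> auto G \<subseteq> U"
    proof
      fix g assume g: "g \<in> Pi\<^sub>E (carrier G) W \<inter> auto G"
      have "g x = f x" if "x \<in> F" for x
        using g that F(2) PiE_mem[of g "carrier G" W x] by (auto simp: W_def)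
      with g F(3) show "g \<in> U" by blast
    qed
    ultimately show ?thesis by blast
  qed
  then show ?L by (subst openin_subopen) blast
qed

end

theory Submission
  imports Defs
begin

text \<open>
  In an inner ultrahomogeneous group every finite piece of an automorphism is inner, so tuples of
  inner automorphisms are dense. The key point is amalgamation: if \<open>C\<close> is finitely generated and
  contains \<open>g\<^sub>i\<close>, and \<open>h\<^sub>i\<close>, \<open>k\<^sub>i\<close> act on \<open>C\<close> as \<open>g\<^sub>i\<close>, then \<open>c\<^sub>i = h\<^sub>i g\<^sub>i\<inverse>\<close> and \<open>d\<^sub>i = k\<^sub>i g\<^sub>i\<inverse>\<close>
  centralize \<open>C\<close>. Choose \<open>x\<^sub>i\<close> centralizing everything in sight and so independent that a word in the
  \<open>x\<^sub>i\<close> falls into the given finitely generated subgroup only if it vanishes at \<open>c\<close> and at \<open>d\<close>. Then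
  \<open>c\<^sub>i x\<^sub>i \<mapsto> d\<^sub>i x\<^sub>i\<close> extends the identity of \<open>C\<close> to a finite partial automorphism, which is inner, and
  \<open>c\<^sub>i x\<^sub>i g\<^sub>i\<close> acts as \<open>h\<^sub>i\<close> and, up to that conjugation, as \<open>k\<^sub>i\<close>. If the age is closed under products,
  the \<open>x\<^sub>i\<close> are copies of the pairs \<open>(c\<^sub>i, d\<^sub>i)\<close>; if it is closed under products with the integers, they
  generate a free group, found by playing ping-pong on a centralizing copy of the integer plane.
  The tuples realizing all such extensions form a dense \<open>G\<^sub>\<delta>\<close> set, and back and forth conjugates
  any two of them.
\<close>

section \<open>Conjugation and partial automorphisms\<close>

context group
begin

lemma conj_by_closed [simp]:
  "\<lbrakk>a \<in> carrier G; g \<in> carrier G\<rbrakk> \<Longrightarrow> conj_by G a g \<in> carrier G"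
  by (simp add: conj_by_def)

lemma conj_by_mult:
  "\<lbrakk>a \<in> carrier G; b \<in> carrier G; g \<in> carrier G\<rbrakk> \<Longrightarrow>
    conj_by G (a \<otimes> b) g = conj_by G a g \<otimes> conj_by G b g"
  using inv_solve_left[of "inv g \<otimes> (b \<otimes> g)" g "b \<otimes> g"] by (simp add: conj_by_def m_assoc)

lemma conj_by_one_left [simp]: "g \<in> carrier G \<Longrightarrow> conj_by G \<one> g = \<one>"
  by (simp add: conj_by_def)

lemma conj_by_one_right [simp]: "a \<in> carrier G \<Longrightarrow> conj_by G a \<one> = a"
  by (simp add: conj_by_def)

lemma conj_by_conj_by:
  "\<lbrakk>a \<in> carrier G; g \<in> carrier G; h \<in> carrier G\<rbrakk> \<Longrightarrow>
    conj_by G (conj_by G a g) h = conj_by G a (g \<otimes> h)"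
  by (simp add: conj_by_def inv_mult_group m_assoc)

lemma conj_by_conj_by_inv [simp]:
  "\<lbrakk>a \<in> carrier G; g \<in> carrier G\<rbrakk> \<Longrightarrow> conj_by G (conj_by G a g) (inv g) = a"
  by (simp add: conj_by_conj_by)

lemma conj_by_inv_conj_by [simp]:
  "\<lbrakk>a \<in> carrier G; g \<in> carrier G\<rbrakk> \<Longrightarrow> conj_by G (conj_by G a (inv g)) g = a"
  by (simp add: conj_by_conj_by)

lemma conj_by_eq_iff:
  "\<lbrakk>a \<in> carrier G; b \<in> carrier G; g \<in> carrier G\<rbrakk> \<Longrightarrow>
    conj_by G a g = conj_by G b g \<longleftrightarrow> a = b"
  by (metis conj_by_conj_by_inv)

lemma conj_by_eq_self_iff:
  "\<lbrakk>a \<in> carrier G; g \<in> carrier G\<rbrakk> \<Longrightarrow> conj_by G a g = a \<longleftrightarrow> a \<otimes> g = g \<otimes> a"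
  by (simp add: conj_by_def m_assoc inv_solve_left' del: l_cancel_one r_cancel_one)

lemma conj_by_distrib:
  "\<lbrakk>a \<in> carrier G; g \<in> carrier G; h \<in> carrier G\<rbrakk> \<Longrightarrow>
    conj_by G (conj_by G a g) h = conj_by G (conj_by G a h) (conj_by G g h)"
  using inv_solve_left[of "inv h \<otimes> (g \<otimes> h)" h "g \<otimes> h"]
  by (simp add: conj_by_conj_by) (simp add: conj_by_def m_assoc)

lemma conj_by_hom: "g \<in> carrier G \<Longrightarrow> (\<lambda>a. conj_by G a g) \<in> hom G G"
  by (simp add: hom_def conj_by_mult)

lemma hom_eq_on_generate:
  assumes "f \<in> hom G G" "f' \<in> hom G G" "S \<subseteq> carrier G" "\<And>a. a \<in> S \<Longrightarrow> f a = f' a"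
    and "a \<in> generate G S"
  shows "f a = f' a"
  using assms(5)
proof (induction rule: generate.induct)
  case one
  show ?case using assms(1,2) by (metis hom_one is_group)
next
  case (incl h)
  then show ?case using assms by auto
next
  case (inv h)
  then have "h \<in> carrier G" using assms by auto
  then show ?case
    using assms inv group_hom.hom_inv[OF group_hom.intro[OF is_group is_group]]
    by (metis group_hom_axioms.intro)
next
  case (eng h1 h2)
  then show ?case using generate_in_carrier[OF assms(3)] assms(1,2) by (simp add: hom_mult)
qed

lemma conj_by_eq_on_generate:
  assumes "g \<in> carrier G" "h \<in> carrier G" "S \<subseteq> carrier G"
    and "\<And>a. a \<in> S \<Longrightarrow> conj_by G a g = conj_by G a h" and "a \<in> generate G S"
  shows "conj_by G a g = conj_by G a h"
  by (rule hom_eq_on_generate[where f = "\<lambda>a. conj_by G a g" and f' = "\<lambda>a. conj_by G a h",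
        OF conj_by_hom[OF assms(1)] conj_by_hom[OF assms(2)] assms(3,4,5)])

lemma generate_centralized:
  assumes "g \<in> carrier G" "S \<subseteq> carrier G" and "\<And>a. a \<in> S \<Longrightarrow> a \<otimes> g = g \<otimes> a"
    and "a \<in> generate G S"
  shows "a \<otimes> g = g \<otimes> a"
proof -
  have "conj_by G b g = conj_by G b \<one>" if "b \<in> S" for b
    using assms(1,2) assms(3)[OF that] that by (subst conj_by_one_right) (auto simp: conj_by_eq_self_iff)
  then have "conj_by G a g = conj_by G a \<one>"
    using assms conj_by_eq_on_generate[of g \<one> S a] by blast
  moreover have "a \<in> carrier G" using assms generate_in_carrier by blast
  ultimately show ?thesis using assms(1) by (simp add: conj_by_eq_self_iff)
qed

end

section \<open>Partial automorphisms as subgroups of the square, realized by conjugation\<close>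

locale inner_ultrahomogeneous_group = group G for G :: "'a monoid" (structure) +
  assumes inner_ultrahomogeneous: "inner_ultrahomogeneous G"
begin

text \<open>A subgroup of the square that meets each axis only in the identity is the graph of an
  isomorphism between its projections. These are finitely generated because \<open>S\<close> is
  finite, so ultrahomogeneity applies to that isomorphism.\<close>

lemma conjugate_if_generate_graph:
  assumes S: "finite S" "S \<subseteq> carrier G \<times> carrier G"
    and R: "\<And>x y. (x, y) \<in> generate (G \<times>\<times> G) S \<Longrightarrow> x = \<one> \<longleftrightarrow> y = \<one>"
  shows "\<exists>g\<in>carrier G. \<forall>(x, y)\<in>generate (G \<times>\<times> G) S. conj_by G x g = y"
proof -
  interpret GG: group "G \<times>\<times> G" by (intro DirProd_group is_group)
  let ?R = "generate (G \<times>\<times> G) S"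
  let ?A = "generate G (fst ` S)" and ?B = "generate G (snd ` S)"
  have Rsub: "subgroup ?R (G \<times>\<times> G)" using S by (intro GG.generate_is_subgroup) auto
  interpret R: subgroup ?R "G \<times>\<times> G" by fact
  interpret f: group_hom "G \<times>\<times> G" G fst
    by unfold_locales (auto simp: hom_def)
  interpret s: group_hom "G \<times>\<times> G" G snd
    by unfold_locales (auto simp: hom_def)
  have A: "?A = fst ` ?R" using f.generate_img[of S] S by simp
  have B: "?B = snd ` ?R" using s.generate_img[of S] S by simp
  have Rc: "x \<in> carrier G" "y \<in> carrier G" if "(x, y) \<in> ?R" for x y
    using R.subset that by auto
  have diff: "(x \<otimes> inv x', y \<otimes> inv y') \<in> ?R" if "(x, y) \<in> ?R" "(x', y') \<in> ?R" for x y x' y'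
    using R.m_closed[OF that(1) R.m_inv_closed[OF that(2)]] Rc[OF that(2)] by simp
  \<comment> \<open>Dividing one pair by another turns the condition at the identity into
    single-valuedness and injectivity at once.\<close>
  have iff: "x = x' \<longleftrightarrow> y = y'" if "(x, y) \<in> ?R" "(x', y') \<in> ?R" for x y x' y'
    using R[OF diff[OF that]] Rc[OF that(1)] Rc[OF that(2)] inv_solve_right'[of \<one> x x']
      inv_solve_right'[of \<one> y y'] by simp
  define p where "p = (\<lambda>x. SOME y. (x, y) \<in> ?R)"
  have pR: "(x, p x) \<in> ?R" if "x \<in> ?A" for x
    using that unfolding A p_def by (auto intro: someI)
  have p: "p x = y" if "(x, y) \<in> ?R" for x y
  proof -
    have "x \<in> ?A" using that unfolding A by force
    then show ?thesis using iff[OF pR that] by blast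
  qed
  have Asub: "subgroup ?A G" "subgroup ?B G" using S by (auto intro!: generate_is_subgroup)
  have "p \<in> iso (G\<lparr>carrier := ?A\<rparr>) (G\<lparr>carrier := ?B\<rparr>)"
  proof (rule isoI)
    show "p \<in> hom (G\<lparr>carrier := ?A\<rparr>) (G\<lparr>carrier := ?B\<rparr>)"
    proof (rule homI; simp)
      show "p x \<in> ?B" if "x \<in> ?A" for x using pR[OF that] unfolding B by force
      show "p (x \<otimes> y) = p x \<otimes> p y" if "x \<in> ?A" "y \<in> ?A" for x y
        using R.m_closed[OF pR[OF that(1)] pR[OF that(2)]] p by simp
    qed
    show "bij_betw p (carrier (G\<lparr>carrier := ?A\<rparr>)) (carrier (G\<lparr>carrier := ?B\<rparr>))"
    proof (simp, rule bij_betw_imageI)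
      show "inj_on p ?A" using iff[OF pR pR] by (auto intro!: inj_onI)
      show "p ` ?A = ?B"
      proof
        show "p ` ?A \<subseteq> ?B" using pR unfolding B by force
        show "?B \<subseteq> p ` ?A" unfolding B A using p by force
      qed
    qed
  qed
  moreover have "fin_gen_subgroup ?A G" "fin_gen_subgroup ?B G"
    unfolding fin_gen_subgroup_def using S
    by (intro exI[of _ "fst ` S"] exI[of _ "snd ` S"] conjI; force)+
  ultimately have "finite_partial_automorphism G ?A p"
    unfolding finite_partial_automorphism_def by blast
  then obtain g where g: "g \<in> carrier G" "\<forall>a\<in>?A. conj_by G a g = p a"
    using inner_ultrahomogeneous unfolding inner_ultrahomogeneous_def by blast
  have "conj_by G x g = y" if "(x, y) \<in> ?R" for x y
  proof -
    have "x \<in> ?A" using that unfolding A by force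
    with that show ?thesis using g(2) p by simp
  qed
  with g(1) show ?thesis by blast
qed

text \<open>The generated subgroup is awkward to describe, so the condition at the identity may be
  checked on any explicit subgroup \<open>R\<close> around it, finitely generated or not.\<close>

corollary conjugate_if_subgroup_graph:
  assumes S: "finite S" "S \<subseteq> R" and sub: "subgroup R (G \<times>\<times> G)"
    and R: "\<And>x y. (x, y) \<in> R \<Longrightarrow> x = \<one> \<longleftrightarrow> y = \<one>"
  shows "\<exists>g\<in>carrier G. \<forall>(x, y)\<in>S. conj_by G x g = y"
proof -
  interpret GG: group "G \<times>\<times> G" by (intro DirProd_group is_group)
  have "S \<subseteq> carrier G \<times> carrier G" using S subgroup.subset[OF sub] by auto
  moreover have "x = \<one> \<longleftrightarrow> y = \<one>" if "(x, y) \<in> generate (G \<times>\<times> G) S" for x y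
    by (rule R, rule subsetD[OF GG.generate_subgroup_incl[OF S(2) sub] that])
  ultimately have "\<exists>g\<in>carrier G. \<forall>(x, y)\<in>generate (G \<times>\<times> G) S. conj_by G x g = y"
    by (rule conjugate_if_generate_graph[OF S(1)])
  then show ?thesis using generate.incl[of _ S "G \<times>\<times> G"] by fast
qed

text \<open>The graph of an injective endomorphism is such a subgroup of the square. For
  automorphisms this yields the density of the inner ones.\<close>

lemma agrees_with_conj_by:
  assumes f: "f \<in> hom G G" "inj_on f (carrier G)" and S: "finite S" "S \<subseteq> carrier G"
  shows "\<exists>g\<in>carrier G. \<forall>x\<in>S. conj_by G x g = f x"
proof -
  interpret f: group_hom G G f using f by unfold_locales
  let ?R = "(\<lambda>x. (x, f x)) ` carrier G"
  interpret GG: group "G \<times>\<times> G" by (intro DirProd_group is_group)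
  have "subgroup ?R (G \<times>\<times> G)"
    by (rule GG.subgroupI) (auto simp: image_iff)
  moreover have "x = \<one> \<longleftrightarrow> y = \<one>" if "(x, y) \<in> ?R" for x y
    using that inj_on_eq_iff[OF f(2), of _ "\<one>"] by auto
  ultimately have "\<exists>g\<in>carrier G. \<forall>(x, y)\<in>(\<lambda>x. (x, f x)) ` S. conj_by G x g = y"
    using S by (intro conjugate_if_subgroup_graph[of _ ?R]) auto
  then show ?thesis by auto
qed

end

section \<open>Words and ping-pong\<close>

primrec pole :: "nat \<times> bool \<Rightarrow> int" where
  "pole (i, s) = 4 * int i + (if s then 0 else 2)"

abbreviation opp :: "'i \<times> bool \<Rightarrow> 'i \<times> bool" where
  "opp \<equiv> apsnd Not"

text \<open>
  The letter \<open>l\<close> acts on the slope \<open>z = u / v\<close> as \<open>z \<mapsto> p + 1 / (z - q)\<close>, with \<open>p\<close> the pole of \<open>l\<close> and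
  \<open>q\<close> that of its inverse. It maps the outside of the unit disc around \<open>q\<close> into the unit disc
  around \<open>p\<close>, and the spacing of the poles makes these discs disjoint.
\<close>

fun schottky :: "nat \<times> bool \<Rightarrow> int \<times> int \<Rightarrow> int \<times> int" where
  "schottky l (u, v) = (pole l * (u - pole (opp l) * v) + v, u - pole (opp l) * v)"

text \<open>Denominators are cleared in the condition on the slope. It fails for
  \<open>v = 0\<close>, so the point at infinity \<open>(1, 0)\<close> is near no letter and can
  serve as base point for ping-pong.\<close>

fun near :: "nat \<times> bool \<Rightarrow> int \<times> int \<Rightarrow> bool" where
  "near l (u, v) \<longleftrightarrow> \<bar>u - pole l * v\<bar> < \<bar>v\<bar>"

lemma opp_opp [simp]: "opp (opp l) = l"
  by (cases l) auto

text \<open>The letter acts by an integer matrix of determinant -1. The opposite letter exchanges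
  the two poles, which gives exactly the inverse matrix.\<close>

lemma schottky_opp [simp]: "schottky (opp l) (schottky l m) = m"
  by (cases m) (simp add: algebra_simps)

lemma schottky_add: "schottky l (m + m') = schottky l m + schottky l m'"
  by (cases m; cases m') (simp add: algebra_simps)

lemma schottky_zero [simp]: "schottky l 0 = 0"
  by (simp add: zero_prod_def)

lemma schottky_eq_zero_iff [simp]: "schottky l m = 0 \<longleftrightarrow> m = 0"
  by (metis schottky_opp schottky_zero)

lemma schottky_uminus: "schottky l (- m) = - schottky l m"
  by (cases m) (simp add: algebra_simps)

lemma pole_diff: "k \<noteq> l \<Longrightarrow> 2 \<le> \<bar>pole k - pole l\<bar>"
  by (cases k; cases l) (auto; presburger)

text \<open>The image is near \<open>l\<close> as soon as the old slope is further than 1 from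
  \<open>pole (opp l)\<close>. It is within 1 of \<open>pole k\<close>, and these two poles are at
  least 2 apart.\<close>

lemma near_schottky:
  assumes "near k m" "k \<noteq> opp l"
  shows "near l (schottky l m)"
proof -
  obtain u v where m: "m = (u, v)" by fastforce
  have "2 * \<bar>v\<bar> \<le> \<bar>pole k - pole (opp l)\<bar> * \<bar>v\<bar>"
    using pole_diff[OF assms(2)] by (intro mult_right_mono) auto
  also have "\<dots> = \<bar>(u - pole (opp l) * v) - (u - pole k * v)\<bar>"
    by (simp add: algebra_simps flip: abs_mult)
  finally have "\<bar>v\<bar> < \<bar>u - pole (opp l) * v\<bar>"
    using assms(1) unfolding m by simp
  then show ?thesis by (simp add: m)
qed

text \<open>The first letter sends infinity to its own pole. Each later letter does not undo its
  predecessor, hence moves the predecessor's disc into its own.\<close>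

lemma near_fold_schottky:
  assumes "successively (\<lambda>k l. l \<noteq> opp k) w" "w \<noteq> []"
  shows "near (last w) (fold schottky w (1, 0))"
  using assms
proof (induction w rule: rev_induct)
  case (snoc l w)
  show ?case
  proof (cases "w = []")
    case False
    then have "near (last w) (fold schottky w (1, 0))" "last w \<noteq> opp l"
      using snoc by (auto simp: successively_append_iff)
    then show ?thesis using near_schottky by simp
  qed simp
qed simp

lemma not_successively_split:
  "\<not> successively P w \<Longrightarrow> \<exists>u k l v. w = u @ k # l # v \<and> \<not> P k l"
proof (induction P w rule: successively.induct)
  case (3 P x y xs)
  then show ?case by (metis append_Cons append_Nil successively.simps(3))
qed auto

section \<open>Evaluation of words in a group\<close>

context group
begin

text \<open>Words are arbitrary lists of signed letters. Concatenation and formal inversion thus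
  stay list operations, and free reduction is confined to the ping-pong argument.\<close>

primrec eval_word :: "('i \<Rightarrow> 'a) \<Rightarrow> ('i \<times> bool) list \<Rightarrow> 'a" where
  "eval_word x [] = \<one>"
| "eval_word x (l # w) = (if snd l then x (fst l) else inv (x (fst l))) \<otimes> eval_word x w"

lemma eval_word_in_subgroup:
  assumes "subgroup H G" "\<And>i. x i \<in> H"
  shows "eval_word x w \<in> H"
  by (induction w) (use assms in \<open>auto simp: subgroup.one_closed subgroup.m_closed subgroup.m_inv_closed\<close>)

lemma eval_word_closed [simp]: "(\<And>i. x i \<in> carrier G) \<Longrightarrow> eval_word x w \<in> carrier G"
  using eval_word_in_subgroup[OF subgroup_self] by blast

lemma eval_word_append:
  assumes "\<And>i. x i \<in> carrier G"
  shows "eval_word x (v @ w) = eval_word x v \<otimes> eval_word x w"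
  by (induction v) (use assms in \<open>auto simp: m_assoc\<close>)

lemma eval_word_opp:
  assumes "\<And>i. x i \<in> carrier G"
  shows "eval_word x (rev (map opp w)) = inv (eval_word x w)"
  by (induction w) (use assms in \<open>auto simp: eval_word_append inv_mult_group\<close>)

lemma eval_word_cancel:
  assumes "\<And>i. x i \<in> carrier G"
  shows "eval_word x (u @ l # opp l # v) = eval_word x (u @ v)"
proof -
  have "eval_word x (l # opp l # v) = eval_word x v"
    using assms by (cases l) (auto simp flip: m_assoc)
  then show ?thesis using assms by (simp only: eval_word_append)
qed

lemma eval_word_hom:
  assumes B: "subgroup B G" and f: "f \<in> hom (G\<lparr>carrier := B\<rparr>) G" and x: "\<And>i. x i \<in> B"
  shows "eval_word (\<lambda>i. f (x i)) w = f (eval_word x w)"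
proof -
  interpret f: group_hom "G\<lparr>carrier := B\<rparr>" G f
    using f B by (intro group_hom.intro group_hom_axioms.intro subgroup.subgroup_is_group is_group)
  have inv: "inv (f b) = f (inv b)" if "b \<in> B" for b
    using f.hom_inv[of b] that m_inv_consistent[OF B that] by simp
  show ?thesis
  proof (induction w)
    case (Cons l w)
    have "eval_word x w \<in> B" using B x by (rule eval_word_in_subgroup)
    then show ?case
      using Cons f.hom_mult[of _ "eval_word x w"] inv x subgroup.m_inv_closed[OF B] by auto
  qed (use f.hom_one in simp)
qed

lemma eval_word_commute:
  assumes "a \<in> carrier G" "\<And>i. x i \<in> carrier G" "\<And>i. x i \<otimes> a = a \<otimes> x i"
  shows "eval_word x w \<otimes> a = a \<otimes> eval_word x w"
proof (rule generate_centralized[of a "range x"])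
  show "eval_word x w \<in> generate G (range x)"
    using assms(2) by (intro eval_word_in_subgroup generate_is_subgroup generate.incl) auto
qed (use assms in auto)

text \<open>Letters of one tuple can be moved past those of the other. This is how a word in
  products such as \<open>c i \<otimes> x i\<close> is split into its two parts.\<close>

lemma eval_word_mult:
  assumes x: "\<And>i. x i \<in> carrier G" and y: "\<And>i. y i \<in> carrier G"
    and xy: "\<And>i j. x i \<otimes> y j = y j \<otimes> x i"
  shows "eval_word (\<lambda>i. x i \<otimes> y i) w = eval_word x w \<otimes> eval_word y w"
proof (induction w)
  case (Cons l w)
  have c: "eval_word x w \<otimes> y (fst l) = y (fst l) \<otimes> eval_word x w"
    using x y xy by (intro eval_word_commute) auto
  have c': "eval_word x w \<otimes> inv (y (fst l)) = inv (y (fst l)) \<otimes> eval_word x w"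
    using c x y by (metis eval_word_closed inv_closed inv_solve_left inv_solve_right m_assoc m_closed)
  have c'': "inv (y (fst l)) \<otimes> inv (x (fst l)) = inv (x (fst l)) \<otimes> inv (y (fst l))"
    using x y xy by (simp flip: inv_mult_group)
  have X: "eval_word x w \<in> carrier G" "eval_word y w \<in> carrier G" using x y by auto
  have eq: "(p \<otimes> q) \<otimes> (eval_word x w \<otimes> eval_word y w) = p \<otimes> eval_word x w \<otimes> (q \<otimes> eval_word y w)"
    if "p \<in> carrier G" "q \<in> carrier G" "eval_word x w \<otimes> q = q \<otimes> eval_word x w" for p q
    using that X by (metis m_assoc m_closed)
  show ?case using eq[of "x (fst l)" "y (fst l)"] eq[of "inv (x (fst l))" "inv (y (fst l))"]
      x y c c' c'' X by (auto simp: Cons inv_mult_group)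
qed simp

text \<open>A word in \<open>x\<close> that fixes the copy of the integer plane reduces freely to
  the empty word, hence is trivial on every tuple. Induction on the length deletes a cancelling pair
  from both evaluations; ping-pong settles reduced words.\<close>

lemma schottky_word_trivial:
  fixes x y :: "nat \<Rightarrow> 'a"
  assumes x: "\<And>i. x i \<in> carrier G" and y: "\<And>i. y i \<in> carrier G"
    and \<phi>: "\<And>m. \<phi> m \<in> carrier G" "inj \<phi>"
    and act: "\<And>i m. conj_by G (\<phi> m) (x i) = \<phi> (schottky (i, True) m)"
    and w: "\<And>m. conj_by G (\<phi> m) (eval_word x w) = \<phi> m"
  shows "eval_word y w = \<one>"
  using w
proof (induction w rule: measure_induct_rule[of length])
  case (less w)
  have act': "conj_by G (\<phi> m) (if snd l then x (fst l) else inv (x (fst l))) = \<phi> (schottky l m)" for l m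
  proof (cases "snd l")
    case False
    have "schottky (fst l, True) (schottky l m) = m"
      using schottky_opp[of l m] False by (cases l) auto
    then have "\<phi> m = conj_by G (\<phi> (schottky l m)) (x (fst l))" using act by simp
    then show ?thesis using False x \<phi>(1) by simp
  next
    case True
    then show ?thesis using act[of m "fst l"] by (cases l) simp
  qed
  \<comment> \<open>Conjugation acts from the right, so the first letter of the word acts first, as
    in \<open>fold\<close>.\<close>
  have fold: "conj_by G (\<phi> m) (eval_word x v) = \<phi> (fold schottky v m)" for v m
  proof (induction v arbitrary: m)
    case (Cons l v)
    have "conj_by G (\<phi> m) (eval_word x (l # v))
        = conj_by G (conj_by G (\<phi> m) (if snd l then x (fst l) else inv (x (fst l)))) (eval_word x v)"
      using x \<phi>(1) by (subst conj_by_conj_by) auto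
    then show ?case unfolding act' using Cons by simp
  qed (use \<phi> in simp)
  show ?case
  proof (cases "successively (\<lambda>k l. l \<noteq> opp k) w")
    case True
    have "fold schottky w (1, 0) = (1, 0)"
      using less.prems[of "(1, 0)"] fold \<phi>(2) by (auto simp: inj_eq)
    \<comment> \<open>A nonempty reduced word would put \<open>(1, 0)\<close> near its last letter,
      but infinity is near none.\<close>
    then have "w = []" using near_fold_schottky[OF True] by fastforce
    then show ?thesis by simp
  next
    case False
    then obtain u l v where w: "w = u @ l # opp l # v"
      using not_successively_split by blast
    then show ?thesis using less.IH[of "u @ v"] less.prems x y by (simp add: eval_word_cancel)
  qed
qed

end

section \<open>Independent centralizing tuples\<close>

lemma (in group) fin_gen_subgroup_generate:
  "\<lbrakk>finite S; S \<subseteq> carrier G\<rbrakk> \<Longrightarrow> fin_gen_subgroup (generate G S) G"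
  unfolding fin_gen_subgroup_def by blast

lemma (in group) fin_gen_subgroupE:
  assumes "fin_gen_subgroup B G"
  obtains S where "finite S" "S \<subseteq> carrier G" "B = generate G S" "subgroup B G" "S \<subseteq> B"
  using assms generate_is_subgroup generate.incl unfolding fin_gen_subgroup_def by (metis subsetI)

lemma (in group) in_Age_subgroup:
  assumes "fin_gen_subgroup B G"
  shows "in_Age (G\<lparr>carrier := B\<rparr>) G"
proof -
  obtain S where S: "finite S" "S \<subseteq> carrier G" "B = generate G S" "subgroup B G" "S \<subseteq> B"
    using assms by (rule fin_gen_subgroupE)
  have "generate (G\<lparr>carrier := B\<rparr>) S = B"
    using generate_consistent[OF S(5,4)] S(3) by simp
  then have "fin_gen_subgroup B (G\<lparr>carrier := B\<rparr>)"
    unfolding fin_gen_subgroup_def using S by (intro exI[of _ S]) simp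
  moreover have "(\<lambda>x. x) \<in> mon (G\<lparr>carrier := B\<rparr>) G"
    using subgroup.subset[OF S(4)] by (auto simp: mon_def hom_def)
  ultimately show ?thesis
    using subgroup.subgroup_is_group[OF S(4) is_group] by (auto simp: in_Age_def fin_gen_group_def)
qed

lemma (in group) integer_homs_eq:
  assumes f: "f \<in> hom integer_group G" and g: "g \<in> hom integer_group G" and "f 1 = g 1"
  shows "f u = g u"
proof -
  interpret f: group_hom integer_group G f
    using f by (intro group_hom.intro group_hom_axioms.intro group_integer_group is_group)
  interpret g: group_hom integer_group G g
    using g by (intro group_hom.intro group_hom_axioms.intro group_integer_group is_group)
  have "f (u + 1) = f u \<otimes> f 1" "f (u - 1) = f u \<otimes> inv (f 1)" for u
    using f.hom_mult[of u 1] f.hom_mult[of u "-1"] f.hom_inv[of 1] by auto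
  moreover have "g (u + 1) = g u \<otimes> g 1" "g (u - 1) = g u \<otimes> inv (g 1)" for u
    using g.hom_mult[of u 1] g.hom_mult[of u "-1"] g.hom_inv[of 1] by auto
  ultimately show ?thesis
    using f.hom_one g.hom_one assms(3) by (induction u rule: int_induct[of _ 0]) simp_all
qed

lemma (in group) integer_hom_in_subgroup:
  assumes f: "f \<in> hom integer_group G" and H: "subgroup H G" and "f 1 \<in> H"
  shows "f u \<in> H"
proof -
  interpret f: group_hom integer_group G f
    using f by (intro group_hom.intro group_hom_axioms.intro group_integer_group is_group)
  have "f (u + 1) = f u \<otimes> f 1" "f (u - 1) = f u \<otimes> inv (f 1)" for u
    using f.hom_mult[of u 1] f.hom_mult[of u "-1"] f.hom_inv[of 1] by auto
  then show ?thesis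
    using f.hom_one assms(3) H
    by (induction u rule: int_induct[of _ 0])
      (simp_all add: subgroup.one_closed subgroup.m_closed subgroup.m_inv_closed)
qed

section \<open>Commuting copies and tuples that separate words\<close>

context inner_ultrahomogeneous_group
begin

text \<open>The age provides a copy of the product of \<open>B\<close> and \<open>H\<close> in
  \<open>G\<close>. Ultrahomogeneity conjugates its first factor back onto \<open>B\<close>, and the
  second factor, carried along, centralizes \<open>B\<close>. As \<open>B\<close> contains the
  identity, the last conclusion includes injectivity of \<open>\<psi>\<close>.\<close>

lemma commuting_copy:
  assumes B: "fin_gen_subgroup B G" and H: "group H" and Age: "in_Age (G\<lparr>carrier := B\<rparr> \<times>\<times> H) G"
  obtains \<psi> where "\<psi> \<in> hom H G"
    "\<And>b h. \<lbrakk>b \<in> B; h \<in> carrier H\<rbrakk> \<Longrightarrow> b \<otimes> \<psi> h = \<psi> h \<otimes> b"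
    "\<And>h. \<lbrakk>h \<in> carrier H; \<psi> h \<in> B\<rbrakk> \<Longrightarrow> h = \<one>\<^bsub>H\<^esub>"
proof -
  obtain S where S: "finite S" "S \<subseteq> carrier G" "B = generate G S" "subgroup B G" "S \<subseteq> B"
    using B by (rule fin_gen_subgroupE)
  interpret H: group H by fact
  interpret B: subgroup B G by fact
  interpret GB: group "G\<lparr>carrier := B\<rparr>" by (rule B.subgroup_is_group[OF is_group])
  interpret GG: group "G \<times>\<times> G" by (intro DirProd_group is_group)
  obtain \<theta> where \<theta>: "\<theta> \<in> hom (G\<lparr>carrier := B\<rparr> \<times>\<times> H) G" "inj_on \<theta> (B \<times> carrier H)"
    using Age by (auto simp: in_Age_def mon_def)
  have \<theta>_closed: "\<theta> (b, h) \<in> carrier G" if "b \<in> B" "h \<in> carrier H" for b h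
    using \<theta>(1) that by (auto simp: hom_def Pi_iff)
  have \<theta>_mult: "\<theta> (b \<otimes> b', h \<otimes>\<^bsub>H\<^esub> h') = \<theta> (b, h) \<otimes> \<theta> (b', h')"
    if "b \<in> B" "b' \<in> B" "h \<in> carrier H" "h' \<in> carrier H" for b b' h h'
    using \<theta>(1) that by (auto simp: hom_def)
  \<comment> \<open>The pairs run from the copy of \<open>b\<close> to \<open>b\<close> itself, so
    the conjugator undoes the embedding on the first factor.\<close>
  let ?f = "\<lambda>b. (\<theta> (b, \<one>\<^bsub>H\<^esub>), b)"
  interpret f: group_hom "G\<lparr>carrier := B\<rparr>" "G \<times>\<times> G" ?f
    by unfold_locales (use \<theta>_closed \<theta>_mult[of _ _ "\<one>\<^bsub>H\<^esub>" "\<one>\<^bsub>H\<^esub>"] in \<open>auto simp: hom_def\<close>)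
  have fB: "generate (G \<times>\<times> G) (?f ` S) = ?f ` B"
    using f.generate_img[of S] S(5) generate_consistent[OF S(5,4)] S(3) by simp
  have \<theta>_one: "\<theta> (\<one>, \<one>\<^bsub>H\<^esub>) = \<one>" using f.hom_one by simp
  have "x = \<one> \<longleftrightarrow> y = \<one>" if "(x, y) \<in> generate (G \<times>\<times> G) (?f ` S)" for x y
  proof -
    have y: "y \<in> B" "x = \<theta> (y, \<one>\<^bsub>H\<^esub>)" using that unfolding fB by auto
    then have "x = \<theta> (\<one>, \<one>\<^bsub>H\<^esub>) \<longleftrightarrow> y = \<one>"
      using inj_on_eq_iff[OF \<theta>(2), of "(y, \<one>\<^bsub>H\<^esub>)" "(\<one>, \<one>\<^bsub>H\<^esub>)"] by auto
    then show ?thesis by (simp add: \<theta>_one)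
  qed
  then have "\<exists>g\<in>carrier G. \<forall>(x, y)\<in>generate (G \<times>\<times> G) (?f ` S). conj_by G x g = y"
    using S \<theta>_closed by (intro conjugate_if_generate_graph) auto
  then obtain g where g: "g \<in> carrier G"
    "\<forall>(x, y)\<in>generate (G \<times>\<times> G) (?f ` S). conj_by G x g = y" by blast
  have g_B: "conj_by G (\<theta> (b, \<one>\<^bsub>H\<^esub>)) g = b" if "b \<in> B" for b
    using g(2) that unfolding fB by auto
  show ?thesis
  proof (rule that)
    let ?\<psi> = "\<lambda>h. conj_by G (\<theta> (\<one>, h)) g"
    show "?\<psi> \<in> hom H G"
      by (rule homI) (use g(1) \<theta>_closed \<theta>_mult[of \<one> \<one>] in \<open>auto simp flip: conj_by_mult\<close>)
    show "b \<otimes> ?\<psi> h = ?\<psi> h \<otimes> b" if "b \<in> B" "h \<in> carrier H" for b h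
    proof -
      have "\<theta> (b, \<one>\<^bsub>H\<^esub>) \<otimes> \<theta> (\<one>, h) = \<theta> (\<one>, h) \<otimes> \<theta> (b, \<one>\<^bsub>H\<^esub>)"
        using \<theta>_mult[of b \<one> "\<one>\<^bsub>H\<^esub>" h] \<theta>_mult[of \<one> b h "\<one>\<^bsub>H\<^esub>"] that by simp
      then have "conj_by G (\<theta> (b, \<one>\<^bsub>H\<^esub>)) g \<otimes> ?\<psi> h = ?\<psi> h \<otimes> conj_by G (\<theta> (b, \<one>\<^bsub>H\<^esub>)) g"
        using g(1) that \<theta>_closed by (simp flip: conj_by_mult)
      then show ?thesis using g_B that by simp
    qed
    show "h = \<one>\<^bsub>H\<^esub>" if h: "h \<in> carrier H" "?\<psi> h \<in> B" for h
    proof -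
      let ?b = "?\<psi> h"
      \<comment> \<open>An element \<open>?b\<close> of \<open>B\<close> equal to
        \<open>\<psi> h\<close> comes both from \<open>?b\<close> in the first factor and from
        \<open>h\<close> in the second. Injectivity of \<open>\<theta>\<close> identifies the
        two.\<close>
      have "conj_by G (\<theta> (?b, \<one>\<^bsub>H\<^esub>)) g = ?\<psi> h" using g_B h by simp
      then have "\<theta> (?b, \<one>\<^bsub>H\<^esub>) = \<theta> (\<one>, h)"
        using g(1) \<theta>_closed h by (simp add: conj_by_eq_iff)
      then show ?thesis using inj_onD[OF \<theta>(2), of "(?b, \<one>\<^bsub>H\<^esub>)" "(\<one>, h)"] h by auto
    qed
  qed
qed

text \<open>The element \<open>c i \<otimes> \<psi> (d i)\<close> stores the pair of
  \<open>c i\<close> and \<open>d i\<close> in the product of \<open>B\<close> with a commuting copy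
  of itself. The map \<open>\<kappa>\<close> then moves these elements off \<open>B\<close>, so a
  word that still falls into \<open>B\<close> was trivial before \<open>\<kappa>\<close>, in both
  components.\<close>

lemma separating_tuple_times:
  fixes c d :: "nat \<Rightarrow> 'a"
  assumes Age: "Age_closed_times G" and B: "fin_gen_subgroup B G"
    and c: "\<And>i. c i \<in> B" and d: "\<And>i. d i \<in> B"
  obtains x :: "nat \<Rightarrow> 'a" where "\<And>i. x i \<in> carrier G"
    "\<And>b i. b \<in> B \<Longrightarrow> b \<otimes> x i = x i \<otimes> b"
    "\<And>w. eval_word x w \<in> B \<Longrightarrow> eval_word c w = \<one> \<and> eval_word d w = \<one>"
proof -
  obtain S where S: "finite S" "S \<subseteq> carrier G" "B = generate G S" "subgroup B G" "S \<subseteq> B"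
    using B by (rule fin_gen_subgroupE)
  interpret B: subgroup B G by fact
  have times: "in_Age (G\<lparr>carrier := B\<rparr> \<times>\<times> G\<lparr>carrier := K\<rparr>) G" if "fin_gen_subgroup K G" for K
    using Age in_Age_subgroup[OF B] in_Age_subgroup[OF that] by (auto simp: Age_closed_times_def)
  obtain \<psi> where \<psi>: "\<psi> \<in> hom (G\<lparr>carrier := B\<rparr>) G"
    "\<And>b h. \<lbrakk>b \<in> B; h \<in> B\<rbrakk> \<Longrightarrow> b \<otimes> \<psi> h = \<psi> h \<otimes> b" "\<And>h. \<lbrakk>h \<in> B; \<psi> h \<in> B\<rbrakk> \<Longrightarrow> h = \<one>"
    using commuting_copy[OF B B.subgroup_is_group[OF is_group] times[OF B]] by auto
  have \<psi>_closed: "\<psi> b \<in> carrier G" if "b \<in> B" for b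
    using \<psi>(1) that by (auto simp: hom_def)
  interpret \<psi>: group_hom "G\<lparr>carrier := B\<rparr>" G \<psi>
    using \<psi>(1) by (intro group_hom.intro group_hom_axioms.intro B.subgroup_is_group is_group)
  let ?K = "generate G (S \<union> \<psi> ` S)"
  have "S \<union> \<psi> ` S \<subseteq> carrier G" using S \<psi>_closed by blast
  then have K: "fin_gen_subgroup ?K G" "subgroup ?K G"
    using S(1) by (auto intro!: fin_gen_subgroup_generate generate_is_subgroup)
  interpret K: subgroup ?K G by fact
  have BK: "B \<subseteq> ?K" unfolding S(3) by (intro mono_generate) auto
  have "\<psi> ` B = generate G (\<psi> ` S)"
    using \<psi>.generate_img[of S] S(5) generate_consistent[OF S(5,4)] S(3) by simp
  then have \<psi>K: "\<psi> b \<in> ?K" if "b \<in> B" for b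
    using that mono_generate[of "\<psi> ` S" "S \<union> \<psi> ` S"] by blast
  obtain \<kappa> where \<kappa>: "\<kappa> \<in> hom (G\<lparr>carrier := ?K\<rparr>) G"
    "\<And>b h. \<lbrakk>b \<in> B; h \<in> ?K\<rbrakk> \<Longrightarrow> b \<otimes> \<kappa> h = \<kappa> h \<otimes> b" "\<And>h. \<lbrakk>h \<in> ?K; \<kappa> h \<in> B\<rbrakk> \<Longrightarrow> h = \<one>"
    using commuting_copy[OF B K.subgroup_is_group[OF is_group] times[OF K(1)]] by auto
  show ?thesis
  proof (rule that)
    let ?y = "\<lambda>i. c i \<otimes> \<psi> (d i)"
    have yK: "?y i \<in> ?K" for i using K.m_closed[of "c i" "\<psi> (d i)"] BK \<psi>K c d by blast
    show "\<kappa> (?y i) \<in> carrier G" for i using \<kappa>(1) yK by (auto simp: hom_def)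
    show "b \<otimes> \<kappa> (?y i) = \<kappa> (?y i) \<otimes> b" if "b \<in> B" for b i using \<kappa>(2)[OF that yK] .
    fix w assume w: "eval_word (\<lambda>i. \<kappa> (?y i)) w \<in> B"
    have cw: "eval_word c w \<in> B" and dw: "eval_word d w \<in> B"
      using c d S(4) by (auto intro: eval_word_in_subgroup)
    have "eval_word (\<lambda>i. \<kappa> (?y i)) w = \<kappa> (eval_word ?y w)"
      by (rule eval_word_hom[OF K(2) \<kappa>(1) yK])
    then have "eval_word ?y w = \<one>"
      using w \<kappa>(3) eval_word_in_subgroup[OF K(2), of ?y w] yK by simp
    moreover have "eval_word ?y w = eval_word c w \<otimes> eval_word (\<lambda>i. \<psi> (d i)) w"
      using c d \<psi>(2) \<psi>_closed by (intro eval_word_mult) auto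
    moreover have "eval_word (\<lambda>i. \<psi> (d i)) w = \<psi> (eval_word d w)"
      by (rule eval_word_hom[OF S(4) \<psi>(1) d])
    ultimately have *: "eval_word c w \<otimes> \<psi> (eval_word d w) = \<one>" by simp
    \<comment> \<open>This puts an element of the copy into \<open>B\<close>, and the two meet only
      in the identity.\<close>
    then have "\<psi> (eval_word d w) = inv (eval_word c w)"
      using cw dw \<psi>_closed by (metis B.mem_carrier inv_equality inv_inv r_inv inv_closed)
    then have "eval_word d w = \<one>" using \<psi>(3) cw dw by simp
    with * show "eval_word c w = \<one> \<and> eval_word d w = \<one>"
      using cw \<psi>.hom_one by simp
  qed
qed

text \<open>Two copies of the integers, the second centralizing \<open>B\<close> and the first, span
  a plane \<open>\<phi>\<close> that centralizes \<open>B\<close> and meets it trivially. A letter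
  on the plane together with the identity on \<open>B\<close> is a partial automorphism, realized by
  some \<open>x i\<close>. A word with value in \<open>B\<close> commutes with the plane, so
  ping-pong makes it freely trivial.\<close>

lemma separating_tuple_times_Z:
  fixes c d :: "nat \<Rightarrow> 'a"
  assumes Age: "Age_closed_times_Z G" and B: "fin_gen_subgroup B G"
    and c: "\<And>i. c i \<in> B" and d: "\<And>i. d i \<in> B"
  obtains x :: "nat \<Rightarrow> 'a" where "\<And>i. x i \<in> carrier G"
    "\<And>b i. b \<in> B \<Longrightarrow> b \<otimes> x i = x i \<otimes> b"
    "\<And>w. eval_word x w \<in> B \<Longrightarrow> eval_word c w = \<one> \<and> eval_word d w = \<one>"
proof -
  note schottky.simps [simp del]
  obtain S where S: "finite S" "S \<subseteq> carrier G" "B = generate G S" "subgroup B G" "S \<subseteq> B"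
    using B by (rule fin_gen_subgroupE)
  interpret B: subgroup B G by fact
  interpret GG: group "G \<times>\<times> G" by (intro DirProd_group is_group)
  have times: "in_Age (G\<lparr>carrier := K\<rparr> \<times>\<times> integer_group) G" if "fin_gen_subgroup K G" for K
    using Age in_Age_subgroup[OF that] by (auto simp: Age_closed_times_Z_def)
  obtain \<psi> where \<psi>: "\<psi> \<in> hom integer_group G"
    "\<And>b u. b \<in> B \<Longrightarrow> b \<otimes> \<psi> u = \<psi> u \<otimes> b" "\<And>u. \<psi> u \<in> B \<Longrightarrow> u = 0"
    using commuting_copy[OF B group_integer_group times[OF B]] by auto
  have \<psi>_closed: "\<psi> u \<in> carrier G" for u
    using \<psi>(1) by (auto simp: hom_def)
  let ?K = "generate G (insert (\<psi> 1) S)"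
  have "insert (\<psi> 1) S \<subseteq> carrier G" using S \<psi>_closed by blast
  then have K: "fin_gen_subgroup ?K G" "subgroup ?K G"
    using S(1) by (auto intro!: fin_gen_subgroup_generate generate_is_subgroup)
  have BK: "B \<subseteq> ?K" unfolding S(3) by (intro mono_generate) auto
  have \<psi>K: "\<psi> u \<in> ?K" for u
    by (rule integer_hom_in_subgroup[OF \<psi>(1) K(2)]) (auto intro: generate.incl)
  obtain \<kappa> where \<kappa>: "\<kappa> \<in> hom integer_group G"
    "\<And>b u. b \<in> ?K \<Longrightarrow> b \<otimes> \<kappa> u = \<kappa> u \<otimes> b" "\<And>u. \<kappa> u \<in> ?K \<Longrightarrow> u = 0"
    using commuting_copy[OF K(1) group_integer_group times[OF K(1)]] by auto
  have \<kappa>_closed: "\<kappa> u \<in> carrier G" for u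
    using \<kappa>(1) by (auto simp: hom_def)
  interpret \<psi>: group_hom integer_group G \<psi>
    using \<psi>(1) by (intro group_hom.intro group_hom_axioms.intro group_integer_group is_group)
  interpret \<kappa>: group_hom integer_group G \<kappa>
    using \<kappa>(1) by (intro group_hom.intro group_hom_axioms.intro group_integer_group is_group)
  define \<phi> where "\<phi> = (\<lambda>m. \<psi> (fst m) \<otimes> \<kappa> (snd m))"
  have \<phi>_closed [simp]: "\<phi> m \<in> carrier G" for m
    using \<psi>_closed \<kappa>_closed by (simp add: \<phi>_def)
  have \<phi>_zero [simp]: "\<phi> 0 = \<one>"
    using \<psi>.hom_one \<kappa>.hom_one by (simp add: \<phi>_def)
  have \<psi>\<kappa>: "\<psi> u \<otimes> \<kappa> v = \<kappa> v \<otimes> \<psi> u" for u v using \<kappa>(2)[OF \<psi>K] .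
  have \<phi>_add: "\<phi> (m + m') = \<phi> m \<otimes> \<phi> m'" for m m'
  proof -
    have "\<phi> (m + m') = \<psi> (fst m) \<otimes> (\<psi> (fst m') \<otimes> \<kappa> (snd m)) \<otimes> \<kappa> (snd m')"
      using \<psi>.hom_mult[of "fst m" "fst m'"] \<kappa>.hom_mult[of "snd m" "snd m'"] \<psi>_closed \<kappa>_closed
      by (simp add: \<phi>_def m_assoc)
    then show ?thesis
      unfolding \<psi>\<kappa>[of "fst m'"] using \<psi>_closed \<kappa>_closed by (simp add: \<phi>_def m_assoc)
  qed
  have \<phi>_B: "m = 0" if "\<phi> m \<in> B" for m
  proof -
    have "inv (\<psi> (fst m)) \<otimes> \<phi> m \<in> ?K"
      using K(2) \<psi>K that BK by (meson subgroup.m_closed subgroup.m_inv_closed subsetD)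
    then have v: "snd m = 0"
      using \<psi>_closed \<kappa>_closed \<kappa>(3) by (simp add: \<phi>_def flip: m_assoc)
    then have "fst m = 0" using that \<psi>(3) \<psi>_closed \<kappa>.hom_one by (simp add: \<phi>_def)
    with v show ?thesis by (simp add: prod_eq_iff)
  qed
  have \<phi>_uminus: "\<phi> (- m) = inv (\<phi> m)" for m
    using \<phi>_add[of "- m" m] by (simp add: inv_equality)
  have "inj \<phi>"
  proof (rule injI)
    fix m m' assume "\<phi> m = \<phi> m'"
    then have "\<phi> (m + - m') = \<one>" by (simp add: \<phi>_add \<phi>_uminus del: add_uminus_conv_diff)
    then show "m = m'" using \<phi>_B[of "m + - m'"] by simp
  qed
  have \<phi>_commute: "b \<otimes> \<phi> m = \<phi> m \<otimes> b" if "b \<in> B" for b m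
  proof -
    have "b \<otimes> \<phi> m = \<psi> (fst m) \<otimes> (b \<otimes> \<kappa> (snd m))"
      using \<psi>(2)[OF that, of "fst m"] that \<psi>_closed \<kappa>_closed
      by (simp add: \<phi>_def flip: m_assoc)
    also have "\<dots> = \<phi> m \<otimes> b"
      using \<kappa>(2)[of b "snd m"] BK that \<psi>_closed \<kappa>_closed by (simp add: \<phi>_def m_assoc subset_iff)
    finally show ?thesis .
  qed
  have ex: "\<exists>g\<in>carrier G. (\<forall>b\<in>S. conj_by G b g = b) \<and>
      (\<forall>m\<in>{(1, 0), (0, 1)}. conj_by G (\<phi> m) g = \<phi> (schottky l m))" for l
  proof -
    \<comment> \<open>The graph of the map that is the identity on \<open>B\<close> and the letter
      \<open>l\<close> on the plane. Only generators of \<open>B\<close> and the basis of the plane,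
      collected in \<open>?S\<close>, have to be realized.\<close>
    let ?R = "{(b \<otimes> \<phi> m, b \<otimes> \<phi> (schottky l m)) |b m. b \<in> B}"
    let ?S = "(\<lambda>b. (b, b)) ` S \<union> (\<lambda>m. (\<phi> m, \<phi> (schottky l m))) ` {(1, 0), (0, 1)}"
    have R: "(b \<otimes> \<phi> m, b \<otimes> \<phi> (schottky l m)) \<in> ?R" if "b \<in> B" for b m
      using that by blast
    have "?S \<subseteq> ?R"
    proof -
      have "(b, b) \<in> ?R" if "b \<in> S" for b using R[of b 0] that S(5) by auto
      moreover have "(\<phi> m, \<phi> (schottky l m)) \<in> ?R" for m using R[of \<one> m] by simp
      ultimately show ?thesis by blast
    qed
    moreover have "subgroup ?R (G \<times>\<times> G)"
    proof (rule GG.subgroupI)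
      show "?R \<subseteq> carrier (G \<times>\<times> G)" by auto
      show "?R \<noteq> {}" using R[OF B.one_closed] by blast
      show "inv\<^bsub>G \<times>\<times> G\<^esub> r \<in> ?R" if rR: "r \<in> ?R" for r
      proof -
        obtain b m where r: "r = (b \<otimes> \<phi> m, b \<otimes> \<phi> (schottky l m))" "b \<in> B" using rR by blast
        have "inv (b \<otimes> \<phi> m') = inv b \<otimes> \<phi> (- m')" for m'
          using r(2) \<phi>_commute[of "inv b" "- m'"] by (simp add: inv_mult_group \<phi>_uminus)
        then have "inv\<^bsub>G \<times>\<times> G\<^esub> r = (inv b \<otimes> \<phi> (- m), inv b \<otimes> \<phi> (schottky l (- m)))"
          using r by (simp add: is_group schottky_uminus)
        then show ?thesis using R[of "inv b" "- m"] r(2) by simp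
      qed
      show "r \<otimes>\<^bsub>G \<times>\<times> G\<^esub> r' \<in> ?R" if rR: "r \<in> ?R" "r' \<in> ?R" for r r'
      proof -
        obtain b m b' m' where r: "r = (b \<otimes> \<phi> m, b \<otimes> \<phi> (schottky l m))" "b \<in> B"
          "r' = (b' \<otimes> \<phi> m', b' \<otimes> \<phi> (schottky l m'))" "b' \<in> B" using rR by blast
        have "b \<otimes> \<phi> k \<otimes> (b' \<otimes> \<phi> k') = b \<otimes> b' \<otimes> \<phi> (k + k')" for k k'
        proof -
          have "b \<otimes> \<phi> k \<otimes> (b' \<otimes> \<phi> k') = b \<otimes> (\<phi> k \<otimes> b') \<otimes> \<phi> k'"
            using r(2,4) by (simp add: m_assoc)
          then show ?thesis using r(2,4) by (simp only: \<phi>_commute[symmetric]) (simp add: m_assoc \<phi>_add)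
        qed
        then have "r \<otimes>\<^bsub>G \<times>\<times> G\<^esub> r' =
            (b \<otimes> b' \<otimes> \<phi> (m + m'), b \<otimes> b' \<otimes> \<phi> (schottky l (m + m')))"
          using r by (simp add: schottky_add)
        then show ?thesis using R[of "b \<otimes> b'" "m + m'"] r(2,4) by simp
      qed
    qed
    moreover have "x = \<one> \<longleftrightarrow> y = \<one>" if xy: "(x, y) \<in> ?R" for x y
    proof -
      obtain b m where bm: "x = b \<otimes> \<phi> m" "y = b \<otimes> \<phi> (schottky l m)" "b \<in> B" using xy by blast
      \<comment> \<open>As \<open>B\<close> and the plane meet trivially, such a product is the
        identity only if both factors are trivial; and a letter sends only 0 to 0.\<close>
      have "b \<otimes> \<phi> k = \<one> \<longleftrightarrow> b = \<one> \<and> k = 0" for k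
      proof
        assume eq: "b \<otimes> \<phi> k = \<one>"
        have "\<phi> k = inv b \<otimes> (b \<otimes> \<phi> k)" using bm(3) by (simp flip: m_assoc)
        then have "\<phi> k \<in> B" using bm(3) eq by simp
        then have "k = 0" by (rule \<phi>_B)
        with eq show "b = \<one> \<and> k = 0" using bm(3) by simp
      qed simp
      then show ?thesis using bm by simp
    qed
    ultimately have "\<exists>g\<in>carrier G. \<forall>(x, y)\<in>?S. conj_by G x g = y"
      using S(1) by (intro conjugate_if_subgroup_graph[of ?S ?R]) auto
    then show ?thesis by (auto simp: ball_Un)
  qed
  define Q where "Q = (\<lambda>i g. g \<in> carrier G \<and> (\<forall>b\<in>S. conj_by G b g = b) \<and>
    (\<forall>m\<in>{(1, 0), (0, 1)}. conj_by G (\<phi> m) g = \<phi> (schottky (i, True) m)))"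
  have "\<forall>i. \<exists>g. Q i g" unfolding Q_def using ex by blast
  then have "\<exists>x. \<forall>i. Q i (x i)" by (rule choice)
  then obtain x where "\<And>i. Q i (x i)" by blast
  then have x: "\<And>i. x i \<in> carrier G" "\<And>i b. b \<in> S \<Longrightarrow> conj_by G b (x i) = b"
    "\<And>i m. m \<in> {(1, 0), (0, 1)} \<Longrightarrow> conj_by G (\<phi> m) (x i) = \<phi> (schottky (i, True) m)"
    unfolding Q_def by blast+
  \<comment> \<open>The choice of \<open>x i\<close> controls only the two basis vectors. Additivity
    along each axis extends this to the whole plane.\<close>
  have act: "conj_by G (\<phi> m) (x i) = \<phi> (schottky (i, True) m)" for i m
  proof -
    have hom: "(\<lambda>u. conj_by G (\<phi> (e u)) (x i)) \<in> hom integer_group G"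
      "(\<lambda>u. \<phi> (schottky (i, True) (e u))) \<in> hom integer_group G"
      if "\<And>u v. e (u + v) = e u + e v" for e :: "int \<Rightarrow> int \<times> int"
      by (rule homI; simp add: x(1) that \<phi>_add schottky_add conj_by_mult)+
    have "conj_by G (\<phi> (u, 0)) (x i) = \<phi> (schottky (i, True) (u, 0))" for u
      by (rule integer_homs_eq[OF hom(1)[of "\<lambda>u. (u, 0)"] hom(2)[of "\<lambda>u. (u, 0)"]])
        (simp_all add: x(3))
    moreover have "conj_by G (\<phi> (0, v)) (x i) = \<phi> (schottky (i, True) (0, v))" for v
      by (rule integer_homs_eq[OF hom(1)[of "\<lambda>v. (0, v)"] hom(2)[of "\<lambda>v. (0, v)"]])
        (simp_all add: x(3))
    moreover have "m = (fst m, 0) + (0, snd m)" by simp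
    ultimately show ?thesis using x(1)
      by (metis \<phi>_add \<phi>_closed conj_by_mult schottky_add)
  qed
  have commute: "b \<otimes> x i = x i \<otimes> b" if "b \<in> B" for b i
  proof (rule generate_centralized[OF x(1) S(2)])
    show "a \<otimes> x i = x i \<otimes> a" if "a \<in> S" for a
      using x(1)[of i] x(2)[OF that, of i] S(2) that conj_by_eq_self_iff[of a "x i"] by blast
    show "b \<in> generate G S" using \<open>b \<in> B\<close> S(3) by simp
  qed
  show ?thesis
  proof (rule that[OF x(1) commute])
    fix w assume w: "eval_word x w \<in> B"
    have fix_\<phi>: "conj_by G (\<phi> m) (eval_word x w) = \<phi> m" for m
      using \<phi>_commute[OF w, of m] x(1) by (simp add: conj_by_eq_self_iff)
    show "eval_word c w = \<one> \<and> eval_word d w = \<one>"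
      using schottky_word_trivial[OF x(1) _ \<phi>_closed \<open>inj \<phi>\<close> act fix_\<phi>] c d by auto
  qed
qed

end

section \<open>Amalgamation\<close>

context inner_ultrahomogeneous_group
begin

text \<open>Because \<open>g\<close> maps into \<open>F\<close>, a conjugator that fixes
  \<open>F\<close> and sends \<open>e i\<close> to \<open>e' i\<close> sends
  \<open>e i \<otimes> g i\<close> to \<open>e' i \<otimes> g i\<close>. On \<open>S\<close> these
  act as \<open>h i\<close> and \<open>k i\<close>, since \<open>x i\<close> centralizes everything
  in sight. So a single tuple continues the common part \<open>F\<close>, \<open>g\<close> in both
  ways, up to \<open>\<delta>\<close>.\<close>

lemma amalgamation:
  assumes Age: "Age_closed_times G \<or> Age_closed_times_Z G"
    and F: "finite F" "F \<subseteq> carrier G" and S: "finite S" "S \<subseteq> carrier G"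
    and g: "g \<in> {..<n::nat} \<rightarrow> F"
    and h: "h \<in> {..<n} \<rightarrow> carrier G" "\<And>i a. \<lbrakk>i < n; a \<in> F\<rbrakk> \<Longrightarrow> conj_by G a (h i) = conj_by G a (g i)"
    and k: "k \<in> {..<n} \<rightarrow> carrier G" "\<And>i a. \<lbrakk>i < n; a \<in> F\<rbrakk> \<Longrightarrow> conj_by G a (k i) = conj_by G a (g i)"
  obtains f \<delta> where "f \<in> {..<n} \<rightarrow> carrier G" "\<delta> \<in> carrier G"
    "\<And>a. a \<in> F \<Longrightarrow> conj_by G a \<delta> = a"
    "\<And>i s. \<lbrakk>i < n; s \<in> S\<rbrakk> \<Longrightarrow> conj_by G s (f i) = conj_by G s (h i)"
    "\<And>i s. \<lbrakk>i < n; s \<in> S\<rbrakk> \<Longrightarrow> conj_by G (conj_by G s \<delta>) (f i) = conj_by G (conj_by G s (k i)) \<delta>"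
proof -
  let ?S = "F \<union> S \<union> h ` {..<n} \<union> k ` {..<n}"
  let ?B = "generate G ?S" and ?C = "generate G F"
  have S': "finite ?S" "?S \<subseteq> carrier G" using F S h k by auto
  have B: "fin_gen_subgroup ?B G" "subgroup ?B G"
    using fin_gen_subgroup_generate[OF S'] generate_is_subgroup[OF S'(2)] .
  interpret B: subgroup ?B G by fact
  interpret C: subgroup ?C G using F(2) by (rule generate_is_subgroup)
  interpret GG: group "G \<times>\<times> G" by (intro DirProd_group is_group)
  have CB: "?C \<subseteq> ?B" by (intro mono_generate) auto
  have gG: "g i \<in> carrier G" "g i \<in> ?C" "g i \<in> ?B" if "i < n" for i
    using that g F generate.incl[of "g i" F G] CB by auto
  \<comment> \<open>Separating tuples are indexed by all natural numbers, so entries from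
    \<open>n\<close> on are filled with the identity, which lies in \<open>?B\<close> and
    centralizes \<open>?C\<close>.\<close>
  define c d where "c = (\<lambda>i. if i < n then h i \<otimes> inv (g i) else \<one>)"
    and "d = (\<lambda>i. if i < n then k i \<otimes> inv (g i) else \<one>)"
  have cB: "c i \<in> ?B" and dB: "d i \<in> ?B" for i
    unfolding c_def d_def using gG(3) generate.incl[of _ ?S G] by auto
  have centralizes: "a \<otimes> (l \<otimes> inv (g i)) = (l \<otimes> inv (g i)) \<otimes> a"
    if l: "l \<in> carrier G" "\<And>a. a \<in> F \<Longrightarrow> conj_by G a l = conj_by G a (g i)" and i: "i < n" and a: "a \<in> ?C"
    for l i a
  proof (rule generate_centralized[OF _ F(2) _ a])
    show "b \<otimes> (l \<otimes> inv (g i)) = (l \<otimes> inv (g i)) \<otimes> b" if b: "b \<in> F" for b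
    proof -
      have bG: "b \<in> carrier G" using b F by auto
      have "conj_by G b (l \<otimes> inv (g i)) = conj_by G (conj_by G b l) (inv (g i))"
        using bG l gG(1)[OF i] by (simp add: conj_by_conj_by)
      also have "\<dots> = b" using l(2)[OF b] bG gG(1)[OF i] by simp
      finally show ?thesis using conj_by_eq_self_iff bG l gG(1)[OF i] by simp
    qed
  qed (use l gG[OF i] in simp)
  have cC: "a \<otimes> c i = c i \<otimes> a" and dC: "a \<otimes> d i = d i \<otimes> a" if "a \<in> ?C" for a i
    using centralizes[of "h i" i a] centralizes[of "k i" i a] h k that
    by (auto simp: c_def d_def Pi_iff)
  obtain x :: "nat \<Rightarrow> 'a" where x: "\<And>i. x i \<in> carrier G"
    "\<And>b i. b \<in> ?B \<Longrightarrow> b \<otimes> x i = x i \<otimes> b"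
    "\<And>w. eval_word x w \<in> ?B \<Longrightarrow> eval_word c w = \<one> \<and> eval_word d w = \<one>"
    using Age separating_tuple_times[OF _ B(1), of c d] separating_tuple_times_Z[OF _ B(1), of c d] cB dB
    by metis
  define e e' where "e = (\<lambda>i. c i \<otimes> x i)" and "e' = (\<lambda>i. d i \<otimes> x i)"
  have closed [simp]: "c i \<in> carrier G" "d i \<in> carrier G" "e i \<in> carrier G" "e' i \<in> carrier G" for i
    using cB dB x(1) by (auto simp: e_def e'_def)
  have eC: "e i \<otimes> a = a \<otimes> e i" and e'C: "e' i \<otimes> a = a \<otimes> e' i" if a: "a \<in> ?C" for a i
  proof -
    have aG: "a \<in> carrier G" and ax: "x i \<otimes> a = a \<otimes> x i" using a CB x(2)[of a i] by auto
    have "p \<otimes> x i \<otimes> a = a \<otimes> (p \<otimes> x i)" if "p \<in> carrier G" "a \<otimes> p = p \<otimes> a" for p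
      using that aG x(1) ax by (metis m_assoc)
    then show "e i \<otimes> a = a \<otimes> e i" "e' i \<otimes> a = a \<otimes> e' i"
      using cC[OF a, of i] dC[OF a, of i] by (simp_all add: e_def e'_def)
  qed
  have e_word: "eval_word e w = eval_word c w \<otimes> eval_word x w"
    and e'_word: "eval_word e' w = eval_word d w \<otimes> eval_word x w" for w
    unfolding e_def e'_def by (rule eval_word_mult[OF _ x(1) x(2)[OF cB]], simp)
      (rule eval_word_mult[OF _ x(1) x(2)[OF dB]], simp)
  \<comment> \<open>The core of the argument: a word in \<open>e\<close> or \<open>e'\<close>
    landing in \<open>?C\<close> forces the word in \<open>x\<close> into \<open>?B\<close>. Then
    the words in \<open>c\<close> and \<open>d\<close> vanish, and both sides equal the word in
    \<open>x\<close>.\<close>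
  have same: "eval_word e w = eval_word e' w" if "eval_word e w \<in> ?C \<or> eval_word e' w \<in> ?C" for w
  proof -
    have cdB: "eval_word c w \<in> ?B" "eval_word d w \<in> ?B"
      using B(2) cB dB by (auto intro: eval_word_in_subgroup)
    have c: "eval_word x w = inv (eval_word c w) \<otimes> eval_word e w"
      unfolding e_word by (subst inv_solve_left) (simp_all add: x(1))
    have d: "eval_word x w = inv (eval_word d w) \<otimes> eval_word e' w"
      unfolding e'_word by (subst inv_solve_left) (simp_all add: x(1))
    have "eval_word x w \<in> ?B"
    proof (cases "eval_word e w \<in> ?C")
      case True
      then show ?thesis unfolding c using CB cdB(1) by blast
    next
      case False
      with that show ?thesis unfolding d using CB cdB(2) by blast
    qed
    then show ?thesis using x(3) by (simp add: e_word e'_word)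
  qed
  \<comment> \<open>The graph of the intended map, the identity on \<open>?C\<close> and
    \<open>e i\<close> to \<open>e' i\<close>. The finitely many pairs to be realized form
    \<open>?T\<close>.\<close>
  let ?R = "{(a \<otimes> eval_word e w, a \<otimes> eval_word e' w) |a w. a \<in> ?C}"
  have R: "(a \<otimes> eval_word e w, a \<otimes> eval_word e' w) \<in> ?R" if "a \<in> ?C" for a w
    using that by blast
  let ?T = "(\<lambda>a. (a, a)) ` F \<union> (\<lambda>i. (e i, e' i)) ` {..<n}"
  have TR: "?T \<subseteq> ?R"
  proof -
    have "(a, a) \<in> ?R" if "a \<in> F" for a using R[of a "[]"] that F generate.incl[of a F G] by auto
    moreover have "(e i, e' i) \<in> ?R" for i using R[of \<one> "[(i, True)]"] by simp
    ultimately show ?thesis by blast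
  qed
  have Rsub: "subgroup ?R (G \<times>\<times> G)"
  proof (rule GG.subgroupI)
    show "?R \<subseteq> carrier (G \<times>\<times> G)" using C.subset by auto
    show "?R \<noteq> {}" using R[OF C.one_closed] by blast
    have comm: "eval_word e w \<otimes> a = a \<otimes> eval_word e w" "eval_word e' w \<otimes> a = a \<otimes> eval_word e' w"
      if "a \<in> ?C" for a w using eC[OF that] e'C[OF that] that by (auto intro: eval_word_commute)
    show "inv\<^bsub>G \<times>\<times> G\<^esub> r \<in> ?R" if rR: "r \<in> ?R" for r
    proof -
      obtain a w where r: "r = (a \<otimes> eval_word e w, a \<otimes> eval_word e' w)" "a \<in> ?C" using rR by blast
      have "inv\<^bsub>G \<times>\<times> G\<^esub> r = (inv a \<otimes> eval_word e (rev (map opp w)), inv a \<otimes> eval_word e' (rev (map opp w)))"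
        using r by (simp add: is_group eval_word_opp inv_mult_group flip: comm)
      then show ?thesis using R[of "inv a"] r(2) by simp
    qed
    show "r \<otimes>\<^bsub>G \<times>\<times> G\<^esub> r' \<in> ?R" if rR: "r \<in> ?R" "r' \<in> ?R" for r r'
    proof -
      obtain a w a' w' where r: "r = (a \<otimes> eval_word e w, a \<otimes> eval_word e' w)" "a \<in> ?C"
        "r' = (a' \<otimes> eval_word e w', a' \<otimes> eval_word e' w')" "a' \<in> ?C" using rR by blast
      have "a \<otimes> p \<otimes> (a' \<otimes> p') = a \<otimes> a' \<otimes> (p \<otimes> p')"
        if "p \<in> carrier G" "p' \<in> carrier G" "p \<otimes> a' = a' \<otimes> p" for p p'
        using that r(2,4) by (metis C.mem_carrier m_assoc m_closed)
      then have "r \<otimes>\<^bsub>G \<times>\<times> G\<^esub> r' = (a \<otimes> a' \<otimes> eval_word e (w @ w'), a \<otimes> a' \<otimes> eval_word e' (w @ w'))"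
        using r comm by (simp add: eval_word_append)
      then show ?thesis using R[of "a \<otimes> a'"] r(2,4) by simp
    qed
  qed
  have Riff: "u = \<one> \<longleftrightarrow> v = \<one>" if uv: "(u, v) \<in> ?R" for u v
  proof -
    obtain a w where aw: "u = a \<otimes> eval_word e w" "v = a \<otimes> eval_word e' w" "a \<in> ?C" using uv by blast
    \<comment> \<open>If one coordinate is the identity, its word is the inverse of \<open>a\<close>
      and lies in \<open>?C\<close>, so \<open>same\<close> makes the other coordinate equal to
      it.\<close>
    have "p \<in> ?C" if "p \<in> carrier G" "a \<otimes> p = \<one>" for p
    proof -
      have "p = inv a" using that aw(3) by (metis C.mem_carrier inv_equality inv_inv)
      then show ?thesis using aw(3) by simp
    qed
    then have "eval_word e w = eval_word e' w" if "u = \<one> \<or> v = \<one>"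
      using that same[of w] aw by auto
    then show ?thesis using aw by auto
  qed
  have "\<exists>\<gamma>\<in>carrier G. \<forall>(u, v)\<in>?T. conj_by G u \<gamma> = v"
    by (rule conjugate_if_subgroup_graph[OF _ TR Rsub Riff]) (use F(1) in simp)
  then obtain \<gamma> where \<gamma>: "\<gamma> \<in> carrier G" and \<gamma>T: "\<forall>(u, v)\<in>?T. conj_by G u \<gamma> = v"
    by (rule bexE)
  have \<gamma>F: "conj_by G a \<gamma> = a" if "a \<in> F" for a
    using bspec[OF \<gamma>T, of "(a, a)"] that by simp
  have \<gamma>e: "conj_by G (e i) \<gamma> = e' i" if "i < n" for i
    using bspec[OF \<gamma>T, of "(e i, e' i)"] that by simp
  \<comment> \<open>\<open>p\<close> keeps \<open>s\<close> inside \<open>?B\<close>, where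
    conjugation by \<open>x i\<close> has no effect.\<close>
  have act: "conj_by G s (p \<otimes> x i \<otimes> g i) = conj_by G s (p \<otimes> g i)"
    if "s \<in> S" "p \<in> ?B" "i < n" for s p i
  proof -
    have sB: "s \<in> ?B" using that generate.incl[of s ?S G] by auto
    then have "conj_by G s p \<in> ?B" using that unfolding conj_by_def by auto
    then have "conj_by G (conj_by G s p) (x i) = conj_by G s p"
      using x(1) x(2)[of "conj_by G s p"] by (simp add: conj_by_eq_self_iff)
    moreover have "conj_by G s (p \<otimes> x i \<otimes> g i) = conj_by G (conj_by G (conj_by G s p) (x i)) (g i)"
      "conj_by G s (p \<otimes> g i) = conj_by G (conj_by G s p) (g i)"
      using sB that x(1) gG(1) by (simp_all add: conj_by_conj_by)
    ultimately show ?thesis by simp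
  qed
  have cg: "c i \<otimes> g i = h i" and dg: "d i \<otimes> g i = k i" if "i < n" for i
    using that gG(1) h(1) k(1) by (auto simp: c_def d_def m_assoc Pi_iff)
  show ?thesis
  \<comment> \<open>\<open>\<gamma>\<close> leads from \<open>e i\<close> to \<open>e' i\<close>.
    Pulling the action of \<open>k\<close> back to the side of \<open>e\<close> therefore takes its
    inverse.\<close>
  proof (rule that[of "\<lambda>i. e i \<otimes> g i" "inv \<gamma>"])
    show "(\<lambda>i. e i \<otimes> g i) \<in> {..<n} \<rightarrow> carrier G" using gG(1) by auto
    show "inv \<gamma> \<in> carrier G" using \<gamma> by simp
    show "conj_by G a (inv \<gamma>) = a" if "a \<in> F" for a
      using conj_by_conj_by_inv[of a \<gamma>] \<gamma> \<gamma>F that F(2) by auto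
    show "conj_by G s (e i \<otimes> g i) = conj_by G s (h i)" if "i < n" "s \<in> S" for i s
      using act[OF that(2) cB that(1)] cg[OF that(1)] by (simp add: e_def)
    show "conj_by G (conj_by G s (inv \<gamma>)) (e i \<otimes> g i) = conj_by G (conj_by G s (k i)) (inv \<gamma>)"
      if "i < n" "s \<in> S" for i s
    proof -
      have sG: "s \<in> carrier G" and gi: "g i \<in> F" "g i \<in> carrier G" using that S(2) g gG by auto
      have "conj_by G (e i \<otimes> g i) \<gamma> = e' i \<otimes> g i"
        using \<gamma> \<gamma>F \<gamma>e that(1) gi by (simp add: conj_by_mult)
      then have "conj_by G (conj_by G (conj_by G s (inv \<gamma>)) (e i \<otimes> g i)) \<gamma> = conj_by G s (e' i \<otimes> g i)"
        using conj_by_distrib[of "conj_by G s (inv \<gamma>)" "e i \<otimes> g i" \<gamma>] sG gi \<gamma> by simp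
      also have "\<dots> = conj_by G s (k i)"
        using act[OF that(2) dB that(1)] dg[OF that(1)] by (simp add: e'_def)
      finally show ?thesis
        using conj_by_conj_by_inv[of "conj_by G (conj_by G s (inv \<gamma>)) (e i \<otimes> g i)" \<gamma>] sG gi \<gamma> by simp
    qed
  qed
qed

end

section \<open>Rich tuples and back and forth\<close>

context group
begin

definition agrees_with_inner :: "nat \<Rightarrow> (nat \<Rightarrow> 'a \<Rightarrow> 'a) \<Rightarrow> (nat \<Rightarrow> 'a) \<Rightarrow> 'a set \<Rightarrow> bool" where
  "agrees_with_inner n \<alpha> g F \<longleftrightarrow> (\<forall>i<n. \<forall>a\<in>F. \<alpha> i a = conj_by G a (g i))"

text \<open>The conjugators belong to the set of agreement, so that this set together with
  \<open>g\<close> can serve as a base for amalgamation.\<close>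

definition locally_inner_on :: "nat \<Rightarrow> 'a set \<Rightarrow> (nat \<Rightarrow> 'a \<Rightarrow> 'a) \<Rightarrow> bool" where
  "locally_inner_on n S \<alpha> \<longleftrightarrow>
    (\<exists>g\<in>{..<n} \<rightarrow>\<^sub>E carrier G. agrees_with_inner n \<alpha> g (S \<union> g ` {..<n}))"

text \<open>An extension property as for Fraisse limits: a tuple continuing the base
  \<open>F\<close>, \<open>g\<close> realizes the continuation \<open>h\<close> on a copy of
  \<open>S\<close> over \<open>F\<close>. Tuples that leave the base satisfy it vacuously, which
  keeps the condition dense.\<close>

definition absorbs ::
    "nat \<Rightarrow> 'a set \<times> 'a set \<times> (nat \<Rightarrow> 'a) \<times> (nat \<Rightarrow> 'a) \<Rightarrow> (nat \<Rightarrow> 'a \<Rightarrow> 'a) \<Rightarrow> bool" where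
  "absorbs n = (\<lambda>(F, S, g, h) \<alpha>. agrees_with_inner n \<alpha> g F \<longrightarrow>
    (\<exists>\<delta>\<in>carrier G. (\<forall>a\<in>F. conj_by G a \<delta> = a) \<and>
      (\<forall>i<n. \<forall>s\<in>S. \<alpha> i (conj_by G s \<delta>) = conj_by G (conj_by G s (h i)) \<delta>)))"

text \<open>Finite sets and extensional conjugators leave only countably many extension problems
  over a countable group.\<close>

definition inner_extensions :: "nat \<Rightarrow> ('a set \<times> 'a set \<times> (nat \<Rightarrow> 'a) \<times> (nat \<Rightarrow> 'a)) set" where
  "inner_extensions n = {(F, S, g, h). finite F \<and> F \<subseteq> carrier G \<and> finite S \<and> S \<subseteq> carrier G \<and>
    g \<in> {..<n} \<rightarrow>\<^sub>E F \<and> h \<in> {..<n} \<rightarrow>\<^sub>E carrier G \<and>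
    (\<forall>i<n. \<forall>a\<in>F. conj_by G a (h i) = conj_by G a (g i))}"

definition rich_tuple :: "nat \<Rightarrow> (nat \<Rightarrow> 'a \<Rightarrow> 'a) \<Rightarrow> bool" where
  "rich_tuple n \<alpha> \<longleftrightarrow>
    (\<forall>S. finite S \<longrightarrow> S \<subseteq> carrier G \<longrightarrow> locally_inner_on n S \<alpha>) \<and>
    (\<forall>e\<in>inner_extensions n. absorbs n e \<alpha>)"

text \<open>A stage of the back and forth: conjugation by \<open>c\<close>, of which only the values
  on \<open>F\<close> count, approximates an automorphism that carries \<open>\<alpha>\<close> to
  \<open>\<beta>\<close>.\<close>

definition partial_conjugacy ::
    "nat \<Rightarrow> (nat \<Rightarrow> 'a \<Rightarrow> 'a) \<Rightarrow> (nat \<Rightarrow> 'a \<Rightarrow> 'a) \<Rightarrow> 'a \<Rightarrow> 'a set \<Rightarrow> bool" where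
  "partial_conjugacy n \<alpha> \<beta> c F \<longleftrightarrow> c \<in> carrier G \<and> finite F \<and> F \<subseteq> carrier G \<and>
    (\<exists>g\<in>{..<n} \<rightarrow>\<^sub>E F. agrees_with_inner n \<alpha> g F \<and>
      (\<forall>i<n. \<forall>a\<in>F. \<beta> i (conj_by G a c) = conj_by G (conj_by G a (g i)) c))"

text \<open>On the image side the conjugators are the \<open>g i\<close> conjugated by
  \<open>c\<close>. Symmetry reduces the back step to the forth step with the tuples
  exchanged.\<close>

lemma partial_conjugacy_sym:
  assumes "partial_conjugacy n \<alpha> \<beta> c F"
  shows "partial_conjugacy n \<beta> \<alpha> (inv c) ((\<lambda>a. conj_by G a c) ` F)"
proof -
  obtain g where c: "c \<in> carrier G" and F: "finite F" "F \<subseteq> carrier G" and g: "g \<in> {..<n} \<rightarrow>\<^sub>E F"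
    and \<alpha>: "\<And>i a. \<lbrakk>i < n; a \<in> F\<rbrakk> \<Longrightarrow> \<alpha> i a = conj_by G a (g i)"
    and \<beta>: "\<And>i a. \<lbrakk>i < n; a \<in> F\<rbrakk> \<Longrightarrow> \<beta> i (conj_by G a c) = conj_by G (conj_by G a (g i)) c"
    using assms unfolding partial_conjugacy_def agrees_with_inner_def by blast
  have gG: "g i \<in> carrier G" if "i < n" for i using g F that by auto
  let ?g = "\<lambda>i\<in>{..<n}. conj_by G (g i) c"
  have "?g \<in> {..<n} \<rightarrow>\<^sub>E (\<lambda>a. conj_by G a c) ` F" using g by auto
  moreover have "agrees_with_inner n \<beta> ?g ((\<lambda>a. conj_by G a c) ` F)"
    unfolding agrees_with_inner_def using \<beta> c F(2) gG
    by (auto simp: subset_iff conj_by_distrib[of _ _ c])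
  moreover have "\<alpha> i (conj_by G b (inv c)) = conj_by G (conj_by G b (?g i)) (inv c)"
    if i: "i < n" and b: "b \<in> (\<lambda>a. conj_by G a c) ` F" for i b
  proof -
    obtain a where a: "a \<in> F" "b = conj_by G a c" using b by blast
    have "a \<in> carrier G" using a F by blast
    then have "conj_by G b (?g i) = conj_by G (conj_by G a (g i)) c"
      using i a c gG[OF i] by (simp add: conj_by_distrib[of _ _ c])
    then show ?thesis using \<open>a \<in> carrier G\<close> a \<alpha>[OF i a(1)] c gG[OF i] by simp
  qed
  ultimately show ?thesis
    using c F unfolding partial_conjugacy_def by (intro conjI bexI[of _ ?g]) auto
qed

text \<open>Local innerness of \<open>\<alpha>\<close> enlarges \<open>F\<close> to a finite set
  with \<open>x\<close> and its own conjugators \<open>h\<close>. Transported by \<open>c\<close>,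
  this is an extension problem for \<open>\<beta>\<close>, absorbed up to some \<open>d\<close> that
  fixes the image of \<open>F\<close>; hence \<open>c \<otimes> d\<close> continues
  \<open>c\<close>.\<close>

lemma partial_conjugacy_forward:
  assumes \<alpha>: "rich_tuple n \<alpha>" and \<beta>: "rich_tuple n \<beta>"
    and pc: "partial_conjugacy n \<alpha> \<beta> c F" and x: "x \<in> carrier G"
  obtains c' F' where "partial_conjugacy n \<alpha> \<beta> c' F'" "F \<subseteq> F'" "x \<in> F'"
    "\<And>a. a \<in> F \<Longrightarrow> conj_by G a c' = conj_by G a c"
proof -
  obtain g where c: "c \<in> carrier G" and F: "finite F" "F \<subseteq> carrier G" and g: "g \<in> {..<n} \<rightarrow>\<^sub>E F"
    and \<alpha>g: "\<And>i a. \<lbrakk>i < n; a \<in> F\<rbrakk> \<Longrightarrow> \<alpha> i a = conj_by G a (g i)"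
    and \<beta>g: "\<And>i a. \<lbrakk>i < n; a \<in> F\<rbrakk> \<Longrightarrow> \<beta> i (conj_by G a c) = conj_by G (conj_by G a (g i)) c"
    using pc unfolding partial_conjugacy_def agrees_with_inner_def by blast
  have "locally_inner_on n (insert x F) \<alpha>" using \<alpha> F x unfolding rich_tuple_def by simp
  then obtain h where h: "h \<in> {..<n} \<rightarrow>\<^sub>E carrier G"
    and \<alpha>h: "agrees_with_inner n \<alpha> h (insert x F \<union> h ` {..<n})"
    unfolding locally_inner_on_def by blast
  let ?F' = "insert x F \<union> h ` {..<n}"
  let ?c = "\<lambda>a. conj_by G a c"
  let ?g = "\<lambda>i\<in>{..<n}. ?c (g i)" and ?h = "\<lambda>i\<in>{..<n}. ?c (h i)"
  have F': "finite ?F'" "?F' \<subseteq> carrier G" using F x h by auto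
  have gG: "g i \<in> carrier G" and hG: "h i \<in> carrier G" if "i < n" for i using g h F that by auto
  have \<beta>F: "agrees_with_inner n \<beta> ?g (?c ` F)"
    unfolding agrees_with_inner_def using \<beta>g c F(2) gG
    by (auto simp: subset_iff conj_by_distrib[of _ _ c])
  have "conj_by G (?c a) (?h i) = conj_by G (?c a) (?g i)" if "i < n" "a \<in> F" for i a
  proof -
    have aG: "a \<in> carrier G" using that F by blast
    have "conj_by G a (h i) = conj_by G a (g i)"
      using \<alpha>g[OF that] \<alpha>h that unfolding agrees_with_inner_def by auto
    then show ?thesis
      using that(1) conj_by_distrib[OF aG hG[OF that(1)] c] conj_by_distrib[OF aG gG[OF that(1)] c] by simp
  qed
  then have "(?c ` F, ?c ` ?F', ?g, ?h) \<in> inner_extensions n"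
    unfolding inner_extensions_def using F F' g h c gG hG by (auto simp: subset_iff)
  then have "absorbs n (?c ` F, ?c ` ?F', ?g, ?h) \<beta>"
    using \<beta> unfolding rich_tuple_def by blast
  then obtain d where d: "d \<in> carrier G" and dF: "\<forall>b\<in>?c ` F. conj_by G b d = b"
    and d\<beta>: "\<forall>i<n. \<forall>s\<in>?c ` ?F'. \<beta> i (conj_by G s d) = conj_by G (conj_by G s (?h i)) d"
    using \<beta>F unfolding absorbs_def split by blast
  show ?thesis
  proof (rule that[of "c \<otimes> d" ?F'])
    have "\<beta> i (conj_by G s (c \<otimes> d)) = conj_by G (conj_by G s (h i)) (c \<otimes> d)"
      if i: "i < n" and s: "s \<in> ?F'" for i s
    proof -
      have sG: "s \<in> carrier G" using s F' by blast
      have "conj_by G (?c s) (?h i) = ?c (conj_by G s (h i))"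
        using i conj_by_distrib[OF sG hG[OF i] c] by simp
      then show ?thesis
        using d\<beta>[rule_format, OF i imageI[OF s]] sG c d hG[OF i]
        by (simp add: conj_by_conj_by m_assoc)
    qed
    moreover have "h \<in> {..<n} \<rightarrow>\<^sub>E ?F'" using h by auto
    ultimately show "partial_conjugacy n \<alpha> \<beta> (c \<otimes> d) ?F'"
      unfolding partial_conjugacy_def using c d F' \<alpha>h by blast
    show "conj_by G a (c \<otimes> d) = conj_by G a c" if "a \<in> F" for a
      using dF that F(2) c d conj_by_conj_by[of a c d] by auto
  qed auto
qed

lemma partial_conjugacy_step:
  assumes \<alpha>: "rich_tuple n \<alpha>" and \<beta>: "rich_tuple n \<beta>"
    and pc: "partial_conjugacy n \<alpha> \<beta> c F" and x: "x \<in> carrier G"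
  shows "\<exists>c' F'. partial_conjugacy n \<alpha> \<beta> c' F' \<and> F \<subseteq> F' \<and> x \<in> F' \<and>
    x \<in> (\<lambda>a. conj_by G a c') ` F' \<and> (\<forall>a\<in>F. conj_by G a c' = conj_by G a c)"
proof -
  obtain c1 F1 where 1: "partial_conjugacy n \<alpha> \<beta> c1 F1" "F \<subseteq> F1" "x \<in> F1"
    "\<And>a. a \<in> F \<Longrightarrow> conj_by G a c1 = conj_by G a c"
    using partial_conjugacy_forward[OF \<alpha> \<beta> pc x] by blast
  obtain c2 F2 where 2: "partial_conjugacy n \<beta> \<alpha> c2 F2" "(\<lambda>a. conj_by G a c1) ` F1 \<subseteq> F2" "x \<in> F2"
    "\<And>b. b \<in> (\<lambda>a. conj_by G a c1) ` F1 \<Longrightarrow> conj_by G b c2 = conj_by G b (inv c1)"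
    using partial_conjugacy_forward[OF \<beta> \<alpha> partial_conjugacy_sym[OF 1(1)] x] by blast
  have c1: "c1 \<in> carrier G" "F1 \<subseteq> carrier G" and c2: "c2 \<in> carrier G" "F2 \<subseteq> carrier G"
    using 1(1) 2(1) by (auto simp: partial_conjugacy_def)
  \<comment> \<open>The stage found for the exchanged tuples is turned around again. Its conjugator
    becomes \<open>inv c2\<close>, which acts on \<open>F1\<close> as \<open>c1\<close>
    does.\<close>
  let ?F = "(\<lambda>b. conj_by G b c2) ` F2"
  have undo: "conj_by G (conj_by G a c1) c2 = a" if "a \<in> F1" for a
    using 2(4)[of "conj_by G a c1"] that c1 by auto
  have F1: "a \<in> ?F" if "a \<in> F1" for a
    using undo[OF that] 2(2) that by (metis imageI subsetD)
  have same: "conj_by G a (inv c2) = conj_by G a c1" if "a \<in> F1" for a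
    using undo[OF that] that c1 c2 conj_by_conj_by_inv[of "conj_by G a c1" c2] by auto
  have "x = conj_by G (conj_by G x c2) (inv c2)" using x c2 by simp
  then have "x \<in> (\<lambda>a. conj_by G a (inv c2)) ` ?F" using 2(3) by blast
  then show ?thesis
    using partial_conjugacy_sym[OF 2(1)] F1 1 same by (intro exI[of _ "inv c2"] exI[of _ ?F]) auto
qed

text \<open>The conjugators \<open>c k\<close> need not converge, but their effect on each element
  is eventually constant, and \<open>\<sigma>\<close> is this limit. Countability lets every element
  enter both the domains and the images.\<close>

theorem rich_tuples_conjugate:
  assumes count: "countable (carrier G)"
    and \<alpha>: "rich_tuple n \<alpha>" and \<beta>: "rich_tuple n \<beta>" and \<alpha>_auto: "\<And>i. i < n \<Longrightarrow> \<alpha> i \<in> auto G"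
  obtains \<sigma> where "\<sigma> \<in> auto G" "\<And>i x. \<lbrakk>i < n; x \<in> carrier G\<rbrakk> \<Longrightarrow> \<sigma> (\<alpha> i x) = \<beta> i (\<sigma> x)"
proof -
  let ?a = "from_nat_into (carrier G)"
  have ne: "carrier G \<noteq> {}" by auto
  have a_in: "?a k \<in> carrier G" for k using ne by (rule from_nat_into)
  let ?e = "(\<lambda>i\<in>{..<n}. \<one>)"
  \<comment> \<open>Local innerness on \<open>{\<one>}\<close> makes both tuples fix the identity,
    so the trivial conjugacy is a first stage.\<close>
  have "agrees_with_inner n \<alpha> ?e {\<one>}" "agrees_with_inner n \<beta> ?e {\<one>}"
  proof -
    have "locally_inner_on n {\<one>} \<alpha>" "locally_inner_on n {\<one>} \<beta>"
      using \<alpha> \<beta> unfolding rich_tuple_def by auto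
    then show "agrees_with_inner n \<alpha> ?e {\<one>}" "agrees_with_inner n \<beta> ?e {\<one>}"
      unfolding locally_inner_on_def agrees_with_inner_def
      by (auto intro!: conj_by_one_left)
  qed
  then have start: "partial_conjugacy n \<alpha> \<beta> \<one> {\<one>}"
    unfolding partial_conjugacy_def agrees_with_inner_def by (intro conjI bexI[of _ ?e]) auto
  define P where "P = (\<lambda>s. partial_conjugacy n \<alpha> \<beta> (fst s) (snd s))"
  define Q where "Q = (\<lambda>k s s'. snd s \<subseteq> snd s' \<and> ?a k \<in> snd s' \<and>
    ?a k \<in> (\<lambda>a. conj_by G a (fst s')) ` snd s' \<and>
    (\<forall>a\<in>snd s. conj_by G a (fst s') = conj_by G a (fst s)))"
  have "\<exists>s. \<forall>k. P (s k) \<and> Q k (s k) (s (Suc k))"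
  proof (rule dependent_nat_choice)
    show "\<exists>s. P s" using start by (auto simp: P_def)
    fix s k assume "P s"
    then show "\<exists>s'. P s' \<and> Q k s s'"
      using partial_conjugacy_step[OF \<alpha> \<beta> _ a_in] unfolding P_def Q_def by fastforce
  qed
  then obtain s where s: "\<And>k. P (s k)" "\<And>k. Q k (s k) (s (Suc k))" by blast
  define c F where "c = (\<lambda>k. fst (s k))" and "F = (\<lambda>k. snd (s k))"
  have c: "c k \<in> carrier G" and F: "F k \<subseteq> carrier G" for k
    using s(1)[of k] by (auto simp: P_def partial_conjugacy_def c_def F_def)
  have chain: "F k \<subseteq> F (Suc k)" "?a k \<in> F (Suc k)" "?a k \<in> (\<lambda>a. conj_by G a (c (Suc k))) ` F (Suc k)"
    "\<And>a. a \<in> F k \<Longrightarrow> conj_by G a (c (Suc k)) = conj_by G a (c k)" for k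
    using s(2)[of k] by (auto simp: Q_def c_def F_def)
  have F_mono: "F k \<subseteq> F l" if "k \<le> l" for k l using that chain(1) by (rule lift_Suc_mono_le[rotated])
  have stable: "conj_by G a (c l) = conj_by G a (c k)" if "k \<le> l" "a \<in> F k" for k l a
    using that
  proof (induction l rule: dec_induct)
    case (step l)
    then show ?case using F_mono[of k l] chain(4)[of a l] by auto
  qed simp
  have cover: "\<exists>k. x \<in> F k" if "x \<in> carrier G" for x
    using that chain(2) from_nat_into_surj[OF count that] by metis
  \<comment> \<open>The least stage is only a choice: by \<open>stable\<close> every later stage
    gives the same value.\<close>
  define \<sigma> where "\<sigma> = (\<lambda>x\<in>carrier G. conj_by G x (c (LEAST k. x \<in> F k)))"
  have \<sigma>: "\<sigma> x = conj_by G x (c k)" if "x \<in> F k" for x k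
    using stable[of "LEAST k. x \<in> F k" k x] that F LeastI[of "\<lambda>k. x \<in> F k"] Least_le[of "\<lambda>k. x \<in> F k"]
    by (auto simp: \<sigma>_def)
  have common: "\<exists>k. x \<in> F k \<and> y \<in> F k \<and> z \<in> F k"
    if "x \<in> carrier G" "y \<in> carrier G" "z \<in> carrier G" for x y z
  proof -
    obtain k l m where "x \<in> F k" "y \<in> F l" "z \<in> F m" using cover \<open>x \<in> _\<close> \<open>y \<in> _\<close> \<open>z \<in> _\<close> by metis
    then show ?thesis
      using F_mono[of k "k + l + m"] F_mono[of l "k + l + m"] F_mono[of m "k + l + m"]
      by (intro exI[of _ "k + l + m"]) auto
  qed
  have \<sigma>_closed: "\<sigma> x \<in> carrier G" if "x \<in> carrier G" for x
    using that c by (simp add: \<sigma>_def)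
  show ?thesis
  proof (rule that)
    have "\<sigma> \<in> hom G G"
    proof (rule homI)
      show "\<sigma> (x \<otimes> y) = \<sigma> x \<otimes> \<sigma> y" if xy: "x \<in> carrier G" "y \<in> carrier G" for x y
      proof -
        obtain k where "x \<in> F k" "y \<in> F k" "x \<otimes> y \<in> F k"
          using common[OF xy m_closed[OF xy]] by blast
        then show ?thesis using \<sigma> xy c by (simp add: conj_by_mult)
      qed
    qed (rule \<sigma>_closed)
    moreover have "inj_on \<sigma> (carrier G)"
    proof (rule inj_onI)
      fix x y assume xy: "x \<in> carrier G" "y \<in> carrier G" "\<sigma> x = \<sigma> y"
      then obtain k where "x \<in> F k" "y \<in> F k" using common[OF xy(1,2,1)] by blast
      then show "x = y" using xy \<sigma> c by (simp add: conj_by_eq_iff)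
    qed
    moreover have "y \<in> \<sigma> ` carrier G" if y: "y \<in> carrier G" for y
    proof -
      obtain k where "y = ?a k" using from_nat_into_surj[OF count y] by metis
      then obtain a where "a \<in> F (Suc k)" "y = conj_by G a (c (Suc k))" using chain(3)[of k] by auto
      then show ?thesis using \<sigma> F by (metis imageI subsetD)
    qed
    ultimately show "\<sigma> \<in> auto G"
      using \<sigma>_closed by (auto simp: auto_def Bij_def bij_betw_def \<sigma>_def)
    show "\<sigma> (\<alpha> i x) = \<beta> i (\<sigma> x)" if i: "i < n" and x: "x \<in> carrier G" for i x
    proof -
      have "\<alpha> i x \<in> carrier G" using \<alpha>_auto[OF i] x by (auto simp: auto_def hom_def)
      then obtain k where k: "x \<in> F k" "\<alpha> i x \<in> F k" using common[OF x x] by blast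
      obtain g where "\<alpha> i x = conj_by G x (g i)"
        "\<beta> i (conj_by G x (c k)) = conj_by G (conj_by G x (g i)) (c k)"
        using s(1)[of k] k i unfolding P_def partial_conjugacy_def agrees_with_inner_def c_def F_def by blast
      then show ?thesis using \<sigma> k by simp
    qed
  qed
qed

end

section \<open>Topology of automorphism tuples\<close>

text \<open>Complements of dense open sets are closed with empty interior. As
  \<open>meagre_in\<close> asks for an exact union, they are cut down to the complement of
  \<open>A\<close>.\<close>

lemma comeagre_in_if_dense_open:
  assumes "countable \<D>" and D: "\<And>D. D \<in> \<D> \<Longrightarrow> openin X D \<and> X closure_of D = topspace X"
    and A: "A \<subseteq> topspace X" "topspace X \<inter> \<Inter>\<D> \<subseteq> A"
  shows "comeagre_in X A"
  unfolding comeagre_in_def meagre_in_def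
proof (intro conjI exI[of _ "(\<lambda>D. (topspace X - D) \<inter> (topspace X - A)) ` \<D>"] ballI)
  fix N assume "N \<in> (\<lambda>D. (topspace X - D) \<inter> (topspace X - A)) ` \<D>"
  then obtain D where "D \<in> \<D>" and N: "N = (topspace X - D) \<inter> (topspace X - A)" by blast
  then have "closedin X (topspace X - D)" "X interior_of (topspace X - D) = {}"
    using D[of D] by (auto simp: interior_of_complement)
  moreover from this have "X closure_of N \<subseteq> topspace X - D"
    unfolding N by (intro closure_of_minimal) auto
  ultimately have "X interior_of (X closure_of N) = {}"
    using interior_of_mono by fastforce
  then show "nowhere_dense_in X N" unfolding nowhere_dense_in_def N by auto
qed (use assms in auto)

lemma openin_product_discrete_topology:
  assumes "U \<subseteq> I \<rightarrow>\<^sub>E C"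
    and "\<And>f. f \<in> U \<Longrightarrow> \<exists>F. finite F \<and> F \<subseteq> I \<and> {g \<in> I \<rightarrow>\<^sub>E C. \<forall>x\<in>F. g x = f x} \<subseteq> U"
  shows "openin (product_topology (\<lambda>_. discrete_topology C) I) U"
  unfolding openin_product_topology_alt
proof (intro ballI)
  fix f assume f: "f \<in> U"
  from assms(2)[OF f] obtain F where F: "finite F" "F \<subseteq> I"
    "{g \<in> I \<rightarrow>\<^sub>E C. \<forall>x\<in>F. g x = f x} \<subseteq> U"
    by (elim exE conjE)
  let ?W = "\<lambda>i. if i \<in> F then {f i} else C"
  have fC: "f \<in> I \<rightarrow>\<^sub>E C" using f assms(1) by blast
  have sub: "Pi\<^sub>E I ?W \<subseteq> {g \<in> I \<rightarrow>\<^sub>E C. \<forall>x\<in>F. g x = f x}"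
  proof
    fix g assume g: "g \<in> Pi\<^sub>E I ?W"
    have "g i \<in> C" if "i \<in> I" for i
      using PiE_mem[OF g that] PiE_mem[OF fC that] by (auto split: if_splits)
    moreover have "g x = f x" if "x \<in> F" for x
      using PiE_mem[OF g, of x] that F(2) by auto
    ultimately show "g \<in> {g \<in> I \<rightarrow>\<^sub>E C. \<forall>x\<in>F. g x = f x}"
      using g by (auto simp: PiE_iff)
  qed
  have fin: "finite {i \<in> I. ?W i \<noteq> topspace (discrete_topology C)}"
    by (rule finite_subset[OF _ F(1)]) auto
  have op: "\<forall>i\<in>I. openin (discrete_topology C) (?W i)"
    using fC F(2) by auto
  have mem: "f \<in> Pi\<^sub>E I ?W" using fC by (auto simp: PiE_iff)
  show "\<exists>W. finite {i \<in> I. W i \<noteq> topspace (discrete_topology C)} \<and>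
      (\<forall>i\<in>I. openin (discrete_topology C) (W i)) \<and> f \<in> Pi\<^sub>E I W \<and> Pi\<^sub>E I W \<subseteq> U"
    by (rule exI[of _ ?W], intro conjI fin op mem order_trans[OF sub F(3)])
qed

section \<open>The space of automorphism tuples\<close>

context group
begin

lemma conj_by_in_auto:
  assumes "g \<in> carrier G"
  shows "(\<lambda>x\<in>carrier G. conj_by G x g) \<in> auto G"
proof -
  have "bij_betw (\<lambda>x. conj_by G x g) (carrier G) (carrier G)"
    using assms by (intro bij_betw_byWitness[of _ "\<lambda>x. conj_by G x (inv g)"]) auto
  then have "bij_betw (\<lambda>x\<in>carrier G. conj_by G x g) (carrier G) (carrier G)"
    by (simp cong: bij_betw_cong)
  then show ?thesis using conj_by_mult assms by (auto simp: auto_def Bij_def hom_def)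
qed

text \<open>Multiplicativity, injectivity and surjectivity split into countably many conditions, one
  for each pair or element. Each is witnessed by finitely many values, hence open.\<close>

lemma gdelta_in_auto:
  assumes "countable (carrier G)"
  shows "gdelta_in (product_topology (\<lambda>_. discrete_topology (carrier G)) (carrier G)) (auto G)"
    (is "gdelta_in ?P _")
proof -
  let ?C = "carrier G" and ?E = "carrier G \<rightarrow>\<^sub>E carrier G"
  let ?hom = "\<lambda>(x, y). {f \<in> ?E. f (x \<otimes> y) = f x \<otimes> f y}"
    and ?inj = "\<lambda>(x, y). {f \<in> ?E. f x = f y \<longrightarrow> x = y}"
    and ?surj = "\<lambda>y. {f \<in> ?E. \<exists>x\<in>?C. f x = y}"
  let ?\<U> = "?hom ` (?C \<times> ?C) \<union> ?inj ` (?C \<times> ?C) \<union> ?surj ` ?C"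
  have eq: "auto G = \<Inter>?\<U>"
  proof
    show "auto G \<subseteq> \<Inter>?\<U>"
    proof (intro subsetI InterI)
      fix f U assume f: "f \<in> auto G" and U: "U \<in> ?\<U>"
      have fE: "f \<in> ?E" using f auto_subset_PiE by blast
      have hom: "\<And>x y. \<lbrakk>x \<in> ?C; y \<in> ?C\<rbrakk> \<Longrightarrow> f (x \<otimes> y) = f x \<otimes> f y"
        and inj: "inj_on f ?C" and surj: "f ` ?C = ?C"
        using f by (auto simp: auto_def hom_def Bij_def bij_betw_def)
      from U show "f \<in> U"
      proof (elim UnE imageE)
        fix p assume "U = ?hom p" "p \<in> ?C \<times> ?C"
        then show ?thesis using fE hom by (cases p) simp
      next
        fix p assume "U = ?inj p" "p \<in> ?C \<times> ?C"
        then show ?thesis using fE inj by (cases p) (simp add: inj_on_def)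
      next
        fix y assume U: "U = ?surj y" and "y \<in> ?C"
        then have "y \<in> f ` ?C" using surj by simp
        then show ?thesis unfolding U using fE by blast
      qed
    qed
    show "\<Inter>?\<U> \<subseteq> auto G"
    proof
      fix f assume f: "f \<in> \<Inter>?\<U>"
      have hom: "f \<in> ?hom p" and inj: "f \<in> ?inj p" if "p \<in> ?C \<times> ?C" for p
        by (rule InterD[OF f], rule UnI1, rule UnI1, rule imageI[OF that])
          (rule InterD[OF f], rule UnI1, rule UnI2, rule imageI[OF that])
      have surj: "f \<in> ?surj y" if "y \<in> ?C" for y
        by (rule InterD[OF f], rule UnI2, rule imageI[OF that])
      have fE: "f \<in> ?E" using surj[OF one_closed] by blast
      have "f \<in> hom G G" using fE hom by (intro homI) auto
      moreover have "inj_on f ?C" using inj by (intro inj_onI) auto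
      moreover have "f ` ?C = ?C"
      proof
        show "f ` ?C \<subseteq> ?C" using fE by auto
        show "?C \<subseteq> f ` ?C" using surj by blast
      qed
      ultimately show "f \<in> auto G"
        using fE by (simp add: auto_def Bij_def bij_betw_def PiE_def)
    qed
  qed
  have "openin ?P U" if "U \<in> ?\<U>" for U
    using that
  proof (elim UnE imageE)
    fix p assume "U = ?hom p" "p \<in> ?C \<times> ?C"
    then show ?thesis
      by (intro openin_product_discrete_topology; cases p)
        (auto intro!: exI[of _ "{fst p, snd p, fst p \<otimes> snd p}"])
  next
    fix p assume "U = ?inj p" "p \<in> ?C \<times> ?C"
    then show ?thesis
      by (intro openin_product_discrete_topology; cases p)
        (auto intro!: exI[of _ "{fst p, snd p}"])
  next
    fix y assume U: "U = ?surj y"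
    show ?thesis
    proof (rule openin_product_discrete_topology)
      fix f assume "f \<in> U"
      then obtain x where "x \<in> ?C" "f x = y" using U by blast
      then show "\<exists>F. finite F \<and> F \<subseteq> ?C \<and> {g \<in> ?E. \<forall>x\<in>F. g x = f x} \<subseteq> U"
        unfolding U by (intro exI[of _ "{x}"]) auto
    qed (use U in auto)
  qed
  moreover have "countable ?\<U>" using assms by auto
  moreover have "?\<U> \<noteq> {}" by auto
  ultimately show ?thesis
    unfolding eq by (intro gdelta_in_Inter open_imp_gdelta_in) auto
qed

text \<open>This is the input to the Baire category theorem, which supplies a rich tuple to start
  from.\<close>

lemma completely_metrizable_space_pointwise_topology:
  assumes "countable (carrier G)"
  shows "completely_metrizable_space (pointwise_topology G)"
  unfolding pointwise_topology_def
  by (intro completely_metrizable_space_gdelta_in gdelta_in_auto assms)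
    (simp add: completely_metrizable_space_product_topology completely_metrizable_space_discrete_topology
      countable_subset[OF _ assms])

abbreviation auto_tuple_topology :: "nat \<Rightarrow> (nat \<Rightarrow> 'a \<Rightarrow> 'a) topology" where
  "auto_tuple_topology n \<equiv> product_topology (\<lambda>_. pointwise_topology G) {..<n}"

lemma topspace_auto_tuple_topology: "topspace (auto_tuple_topology n) = {..<n} \<rightarrow>\<^sub>E auto G"
  by (simp add: topspace_pointwise_topology AutoGroup_def)

lemma openin_auto_tuple_topology_iff:
  "openin (auto_tuple_topology n) U \<longleftrightarrow> U \<subseteq> {..<n} \<rightarrow>\<^sub>E auto G \<and>
    (\<forall>\<alpha>\<in>U. \<exists>S. finite S \<and> S \<subseteq> carrier G \<and>
      {\<beta> \<in> {..<n} \<rightarrow>\<^sub>E auto G. \<forall>i<n. \<forall>x\<in>S. \<beta> i x = \<alpha> i x} \<subseteq> U)"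
    (is "?L \<longleftrightarrow> ?R")
proof
  assume L: ?L
  show ?R
  proof (intro conjI ballI)
    show UE: "U \<subseteq> {..<n} \<rightarrow>\<^sub>E auto G"
      using openin_subset[OF L] unfolding topspace_auto_tuple_topology .
    fix \<alpha> assume "\<alpha> \<in> U"
    from bspec[OF L[unfolded openin_product_topology_alt] this]
    obtain V where V: "\<forall>i\<in>{..<n}. openin (pointwise_topology G) (V i)"
      "\<alpha> \<in> Pi\<^sub>E {..<n} V" "Pi\<^sub>E {..<n} V \<subseteq> U"
      by (elim exE conjE)
    have "\<forall>i\<in>{..<n}. \<exists>F. finite F \<and> F \<subseteq> carrier G \<and> {g \<in> auto G. \<forall>x\<in>F. g x = \<alpha> i x} \<subseteq> V i"
    proof
      fix i assume "i \<in> {..<n}"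
      then have "openin (pointwise_topology G) (V i)" "\<alpha> i \<in> V i"
        using V(1) PiE_mem[OF V(2), of i] by auto
      then show "\<exists>F. finite F \<and> F \<subseteq> carrier G \<and> {g \<in> auto G. \<forall>x\<in>F. g x = \<alpha> i x} \<subseteq> V i"
        unfolding openin_pointwise_topology_iff by blast
    qed
    from bchoice[OF this] obtain F where F: "\<forall>i\<in>{..<n}. finite (F i) \<and> F i \<subseteq> carrier G \<and>
        {g \<in> auto G. \<forall>x\<in>F i. g x = \<alpha> i x} \<subseteq> V i" by (rule exE)
    show "\<exists>S. finite S \<and> S \<subseteq> carrier G \<and>
        {\<beta> \<in> {..<n} \<rightarrow>\<^sub>E auto G. \<forall>i<n. \<forall>x\<in>S. \<beta> i x = \<alpha> i x} \<subseteq> U"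
    proof (intro exI[of _ "\<Union>i<n. F i"] conjI)
      show "{\<beta> \<in> {..<n} \<rightarrow>\<^sub>E auto G. \<forall>i<n. \<forall>x\<in>\<Union>i<n. F i. \<beta> i x = \<alpha> i x} \<subseteq> U"
      proof
        fix \<beta> assume \<beta>: "\<beta> \<in> {\<beta> \<in> {..<n} \<rightarrow>\<^sub>E auto G. \<forall>i<n. \<forall>x\<in>\<Union>i<n. F i. \<beta> i x = \<alpha> i x}"
        have "\<beta> i \<in> V i" if "i < n" for i
        proof -
          have "\<beta> i \<in> {g \<in> auto G. \<forall>x\<in>F i. g x = \<alpha> i x}" using \<beta> that by (auto simp: PiE_iff)
          then show ?thesis using F that by blast
        qed
        then have "\<beta> \<in> Pi\<^sub>E {..<n} V" using \<beta> by (simp add: PiE_iff)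
        then show "\<beta> \<in> U" using V(3) by blast
      qed
    qed (use F in auto)
  qed
next
  assume R: ?R
  show ?L unfolding openin_product_topology_alt
  proof (intro ballI)
    fix \<alpha> assume \<alpha>: "\<alpha> \<in> U"
    then obtain S where S: "finite S" "S \<subseteq> carrier G"
      "{\<beta> \<in> {..<n} \<rightarrow>\<^sub>E auto G. \<forall>i<n. \<forall>x\<in>S. \<beta> i x = \<alpha> i x} \<subseteq> U" using R by blast
    have \<alpha>E: "\<alpha> \<in> {..<n} \<rightarrow>\<^sub>E auto G" using R \<alpha> by blast
    let ?V = "\<lambda>i. {f \<in> auto G. \<forall>x\<in>S. f x = \<alpha> i x}"
    have op: "\<forall>i\<in>{..<n}. openin (pointwise_topology G) (?V i)"
      unfolding openin_pointwise_topology_iff using S(1,2) by (auto intro!: exI[of _ S])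
    have mem: "\<alpha> \<in> Pi\<^sub>E {..<n} ?V" using \<alpha>E by (auto simp: PiE_iff)
    have "Pi\<^sub>E {..<n} ?V \<subseteq> {\<beta> \<in> {..<n} \<rightarrow>\<^sub>E auto G. \<forall>i<n. \<forall>x\<in>S. \<beta> i x = \<alpha> i x}"
      by (auto simp: PiE_iff)
    then have sub: "Pi\<^sub>E {..<n} ?V \<subseteq> U" using S(3) by (rule order_trans)
    show "\<exists>V. finite {i \<in> {..<n}. V i \<noteq> topspace (pointwise_topology G)} \<and>
        (\<forall>i\<in>{..<n}. openin (pointwise_topology G) (V i)) \<and> \<alpha> \<in> Pi\<^sub>E {..<n} V \<and> Pi\<^sub>E {..<n} V \<subseteq> U"
      by (rule exI[of _ ?V], intro conjI op mem sub) simp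
  qed
qed

lemma dense_in_auto_tuple_topology:
  assumes "\<And>\<alpha> S. \<lbrakk>\<alpha> \<in> {..<n} \<rightarrow>\<^sub>E auto G; finite S; S \<subseteq> carrier G\<rbrakk> \<Longrightarrow>
    \<exists>\<beta>\<in>D. \<beta> \<in> {..<n} \<rightarrow>\<^sub>E auto G \<and> (\<forall>i<n. \<forall>x\<in>S. \<beta> i x = \<alpha> i x)"
  shows "auto_tuple_topology n closure_of D = topspace (auto_tuple_topology n)"
  unfolding dense_intersects_open
proof (intro allI impI)
  fix U assume U: "openin (auto_tuple_topology n) U \<and> U \<noteq> {}"
  then obtain \<alpha> where "\<alpha> \<in> U" by blast
  then obtain S where "finite S" "S \<subseteq> carrier G" "\<alpha> \<in> {..<n} \<rightarrow>\<^sub>E auto G"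
    "{\<beta> \<in> {..<n} \<rightarrow>\<^sub>E auto G. \<forall>i<n. \<forall>x\<in>S. \<beta> i x = \<alpha> i x} \<subseteq> U"
    using U unfolding openin_auto_tuple_topology_iff by blast
  then show "D \<inter> U \<noteq> {}" using assms[of \<alpha> S] by blast
qed

lemma openin_locally_inner_on:
  assumes "finite S" "S \<subseteq> carrier G"
  shows "openin (auto_tuple_topology n) {\<alpha> \<in> {..<n} \<rightarrow>\<^sub>E auto G. locally_inner_on n S \<alpha>}"
  unfolding openin_auto_tuple_topology_iff
proof (intro conjI ballI)
  fix \<alpha> assume "\<alpha> \<in> {\<alpha> \<in> {..<n} \<rightarrow>\<^sub>E auto G. locally_inner_on n S \<alpha>}"
  then obtain g where g: "g \<in> {..<n} \<rightarrow>\<^sub>E carrier G" "agrees_with_inner n \<alpha> g (S \<union> g ` {..<n})"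
    unfolding locally_inner_on_def by blast
  have "agrees_with_inner n \<beta> g (S \<union> g ` {..<n})"
    if "\<forall>i<n. \<forall>x\<in>S \<union> g ` {..<n}. \<beta> i x = \<alpha> i x" for \<beta>
    using g(2) that unfolding agrees_with_inner_def by simp
  then show "\<exists>T. finite T \<and> T \<subseteq> carrier G \<and>
      {\<beta> \<in> {..<n} \<rightarrow>\<^sub>E auto G. \<forall>i<n. \<forall>x\<in>T. \<beta> i x = \<alpha> i x}
      \<subseteq> {\<alpha> \<in> {..<n} \<rightarrow>\<^sub>E auto G. locally_inner_on n S \<alpha>}"
    using assms g(1) unfolding locally_inner_on_def by (intro exI[of _ "S \<union> g ` {..<n}"]) auto
qed auto

text \<open>Either way of satisfying the implication depends on finitely many values: a disagreement
  with \<open>g\<close> on \<open>F\<close>, or success with one fixed conjugator on the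
  corresponding copy of \<open>S\<close>.\<close>

lemma openin_absorbs:
  assumes "e \<in> inner_extensions n"
  shows "openin (auto_tuple_topology n) {\<alpha> \<in> {..<n} \<rightarrow>\<^sub>E auto G. absorbs n e \<alpha>}"
  unfolding openin_auto_tuple_topology_iff
proof (intro conjI ballI)
  obtain F S g h where e: "e = (F, S, g, h)" by (cases e)
  then have FS: "finite F" "F \<subseteq> carrier G" "finite S" "S \<subseteq> carrier G"
    using assms by (auto simp: inner_extensions_def)
  fix \<alpha> assume \<alpha>: "\<alpha> \<in> {\<alpha> \<in> {..<n} \<rightarrow>\<^sub>E auto G. absorbs n e \<alpha>}"
  show "\<exists>T. finite T \<and> T \<subseteq> carrier G \<and>
      {\<beta> \<in> {..<n} \<rightarrow>\<^sub>E auto G. \<forall>i<n. \<forall>x\<in>T. \<beta> i x = \<alpha> i x}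
      \<subseteq> {\<alpha> \<in> {..<n} \<rightarrow>\<^sub>E auto G. absorbs n e \<alpha>}"
  proof (cases "agrees_with_inner n \<alpha> g F")
    case False
    then have "\<not> agrees_with_inner n \<beta> g F" if "\<forall>i<n. \<forall>x\<in>F. \<beta> i x = \<alpha> i x" for \<beta>
      using that unfolding agrees_with_inner_def by simp
    then show ?thesis using FS unfolding absorbs_def e by (intro exI[of _ F]) auto
  next
    case True
    then obtain d where d: "d \<in> carrier G" "\<forall>a\<in>F. conj_by G a d = a"
      "\<forall>i<n. \<forall>s\<in>S. \<alpha> i (conj_by G s d) = conj_by G (conj_by G s (h i)) d"
      using \<alpha> unfolding absorbs_def e by auto
    have "\<forall>i<n. \<forall>s\<in>S. \<beta> i (conj_by G s d) = conj_by G (conj_by G s (h i)) d"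
      if "\<forall>i<n. \<forall>x\<in>(\<lambda>s. conj_by G s d) ` S. \<beta> i x = \<alpha> i x" for \<beta>
      using d(3) that by auto
    then have "absorbs n e \<beta>" if "\<forall>i<n. \<forall>x\<in>(\<lambda>s. conj_by G s d) ` S. \<beta> i x = \<alpha> i x" for \<beta>
      using d(1,2) that unfolding absorbs_def e split by blast
    then show ?thesis
      using FS d(1) by (intro exI[of _ "(\<lambda>s. conj_by G s d) ` S"]) auto
  qed
qed auto

lemma countable_inner_extensions:
  assumes "countable (carrier G)"
  shows "countable (inner_extensions n)"
proof (rule countable_subset)
  let ?Fin = "{F. finite F \<and> F \<subseteq> carrier G}" and ?T = "{..<n} \<rightarrow>\<^sub>E carrier G"
  show "inner_extensions n \<subseteq> ?Fin \<times> ?Fin \<times> ?T \<times> ?T"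
    unfolding inner_extensions_def by (auto simp: PiE_iff extensional_def)
  show "countable (?Fin \<times> ?Fin \<times> ?T \<times> ?T)"
    using assms by (intro countable_SIGMA countable_Collect_finite_subset countable_PiE) auto
qed

text \<open>Multiplication in \<open>AutoGroup G\<close> is composition, so the intertwining
  equation says that \<open>\<beta> i\<close> is \<open>\<alpha> i\<close> conjugated by
  \<open>\<sigma>\<close> in the sense of \<open>conj_by\<close>.\<close>

lemma diagonal_conj_orbit_AutoGroup:
  assumes \<alpha>: "\<alpha> \<in> {..<n} \<rightarrow>\<^sub>E auto G" and \<beta>: "\<beta> \<in> {..<n} \<rightarrow>\<^sub>E auto G" and \<sigma>: "\<sigma> \<in> auto G"
    and eq: "\<And>i x. \<lbrakk>i < n; x \<in> carrier G\<rbrakk> \<Longrightarrow> \<sigma> (\<beta> i x) = \<alpha> i (\<sigma> x)"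
  shows "\<beta> \<in> diagonal_conj_orbit (AutoGroup G) n \<alpha>"
proof -
  interpret A: group "AutoGroup G" by (rule AutoGroup)
  have carrier: "carrier (AutoGroup G) = auto G" by (simp add: AutoGroup_def)
  have mult: "f \<otimes>\<^bsub>AutoGroup G\<^esub> f' = compose (carrier G) f f'" if "f \<in> auto G" "f' \<in> auto G" for f f'
    using that by (simp add: AutoGroup_def BijGroup_def auto_def)
  have "\<beta> i = conj_by (AutoGroup G) (\<alpha> i) \<sigma>" if i: "i < n" for i
  proof -
    have in_auto: "\<alpha> i \<in> auto G" "\<beta> i \<in> auto G" using \<alpha> \<beta> i by auto
    then have "\<sigma> \<otimes>\<^bsub>AutoGroup G\<^esub> \<beta> i = \<alpha> i \<otimes>\<^bsub>AutoGroup G\<^esub> \<sigma>"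
      using \<sigma> eq[OF i] by (auto simp: mult compose_def)
    then have "\<beta> i = inv\<^bsub>AutoGroup G\<^esub> \<sigma> \<otimes>\<^bsub>AutoGroup G\<^esub> (\<alpha> i \<otimes>\<^bsub>AutoGroup G\<^esub> \<sigma>)"
      using \<sigma> in_auto A.inv_solve_left[of "\<beta> i" \<sigma>] A.m_closed[of "\<alpha> i" \<sigma>] by (simp add: carrier)
    then show ?thesis
      using \<sigma> in_auto A.inv_closed[of \<sigma>] by (simp add: conj_by_def A.m_assoc carrier)
  qed
  then have "\<beta> = (\<lambda>i\<in>{..<n}. conj_by (AutoGroup G) (\<alpha> i) \<sigma>)"
    using \<beta> by (auto simp: PiE_iff extensional_def)
  then show ?thesis using \<sigma> unfolding diagonal_conj_orbit_def carrier by blast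
qed

end

section \<open>Density of the conditions and the conclusion\<close>

context inner_ultrahomogeneous_group
begin

lemma auto_tuple_agrees_with_inner:
  assumes "\<alpha> \<in> {..<n} \<rightarrow>\<^sub>E auto G" "finite S" "S \<subseteq> carrier G"
  obtains g where "g \<in> {..<n} \<rightarrow>\<^sub>E carrier G" "agrees_with_inner n \<alpha> g S"
proof -
  have "\<exists>g\<in>carrier G. \<forall>x\<in>S. conj_by G x g = \<alpha> i x" if "i < n" for i
    using assms that PiE_mem[OF assms(1), of i]
    by (intro agrees_with_conj_by) (auto simp: auto_def Bij_def bij_betw_def)
  then obtain g where "\<And>i. i < n \<Longrightarrow> g i \<in> carrier G \<and> (\<forall>x\<in>S. conj_by G x (g i) = \<alpha> i x)"
    by metis
  then show ?thesis
    by (intro that[of "restrict g {..<n}"]) (auto simp: agrees_with_inner_def)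
qed

definition inner_tuple :: "nat \<Rightarrow> (nat \<Rightarrow> 'a) \<Rightarrow> nat \<Rightarrow> 'a \<Rightarrow> 'a" where
  "inner_tuple n g = (\<lambda>i\<in>{..<n}. \<lambda>x\<in>carrier G. conj_by G x (g i))"

lemma inner_tuple_in_auto: "g \<in> {..<n} \<rightarrow> carrier G \<Longrightarrow> inner_tuple n g \<in> {..<n} \<rightarrow>\<^sub>E auto G"
  by (auto simp: inner_tuple_def intro: conj_by_in_auto)

lemma inner_tuple_apply: "\<lbrakk>i < n; x \<in> carrier G\<rbrakk> \<Longrightarrow> inner_tuple n g i x = conj_by G x (g i)"
  by (simp add: inner_tuple_def)

text \<open>A tuple of inner automorphisms agrees with its conjugators everywhere, in particular at
  the conjugators, and such tuples are dense.\<close>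

lemma dense_locally_inner_on:
  assumes S: "finite S" "S \<subseteq> carrier G"
  shows "auto_tuple_topology n closure_of {\<alpha> \<in> {..<n} \<rightarrow>\<^sub>E auto G. locally_inner_on n S \<alpha>}
    = topspace (auto_tuple_topology n)"
proof (rule dense_in_auto_tuple_topology)
  fix \<alpha> T assume "\<alpha> \<in> {..<n} \<rightarrow>\<^sub>E auto G" "finite T" "T \<subseteq> carrier G"
  then obtain g where g: "g \<in> {..<n} \<rightarrow>\<^sub>E carrier G" "agrees_with_inner n \<alpha> g T"
    by (rule auto_tuple_agrees_with_inner)
  have "agrees_with_inner n (inner_tuple n g) g (S \<union> g ` {..<n})"
    using S g(1) by (auto simp: agrees_with_inner_def inner_tuple_apply subset_iff PiE_iff)
  then have "locally_inner_on n S (inner_tuple n g)" using g(1) by (auto simp: locally_inner_on_def)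
  moreover have "inner_tuple n g \<in> {..<n} \<rightarrow>\<^sub>E auto G"
    using g(1) by (intro inner_tuple_in_auto) auto
  moreover have "\<forall>i<n. \<forall>x\<in>T. inner_tuple n g i x = \<alpha> i x"
    using g(2) \<open>T \<subseteq> carrier G\<close> by (auto simp: agrees_with_inner_def inner_tuple_apply subset_iff)
  ultimately show "\<exists>\<beta>\<in>{\<alpha> \<in> {..<n} \<rightarrow>\<^sub>E auto G. locally_inner_on n S \<alpha>}.
      \<beta> \<in> {..<n} \<rightarrow>\<^sub>E auto G \<and> (\<forall>i<n. \<forall>x\<in>T. \<beta> i x = \<alpha> i x)" by blast
qed

text \<open>If \<open>\<alpha>\<close> leaves the base, it qualifies itself. Otherwise an inner
  tuple \<open>k\<close> imitates it on \<open>F \<union> T\<close>, and amalgamating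
  \<open>k\<close> with \<open>h\<close> over \<open>F\<close> gives an inner tuple that still
  imitates \<open>\<alpha>\<close> on \<open>T\<close> and absorbs the extension.\<close>

lemma dense_absorbs:
  assumes Age: "Age_closed_times G \<or> Age_closed_times_Z G" and e: "e \<in> inner_extensions n"
  shows "auto_tuple_topology n closure_of {\<alpha> \<in> {..<n} \<rightarrow>\<^sub>E auto G. absorbs n e \<alpha>}
    = topspace (auto_tuple_topology n)"
proof (rule dense_in_auto_tuple_topology)
  obtain F S g h where eq: "e = (F, S, g, h)" by (cases e)
  then have F: "finite F" "F \<subseteq> carrier G" and S: "finite S" "S \<subseteq> carrier G"
    and g: "g \<in> {..<n} \<rightarrow> F" and h: "h \<in> {..<n} \<rightarrow> carrier G"
    and hg: "\<And>i a. \<lbrakk>i < n; a \<in> F\<rbrakk> \<Longrightarrow> conj_by G a (h i) = conj_by G a (g i)"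
    using e by (auto simp: inner_extensions_def PiE_iff)
  fix \<alpha> T assume \<alpha>: "\<alpha> \<in> {..<n} \<rightarrow>\<^sub>E auto G" and T: "finite T" "T \<subseteq> carrier G"
  show "\<exists>\<beta>\<in>{\<alpha> \<in> {..<n} \<rightarrow>\<^sub>E auto G. absorbs n e \<alpha>}.
      \<beta> \<in> {..<n} \<rightarrow>\<^sub>E auto G \<and> (\<forall>i<n. \<forall>x\<in>T. \<beta> i x = \<alpha> i x)"
  proof (cases "agrees_with_inner n \<alpha> g F")
    case False
    then show ?thesis using \<alpha> unfolding absorbs_def eq by auto
  next
    case True
    have "finite (F \<union> T)" "F \<union> T \<subseteq> carrier G" using F T by auto
    with \<alpha> obtain k where k: "k \<in> {..<n} \<rightarrow>\<^sub>E carrier G" "agrees_with_inner n \<alpha> k (F \<union> T)"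
      by (rule auto_tuple_agrees_with_inner)
    have kG: "k \<in> {..<n} \<rightarrow> carrier G" using k(1) by auto
    have kg: "conj_by G a (k i) = conj_by G a (g i)" if "i < n" "a \<in> F" for i a
      using True k(2) that unfolding agrees_with_inner_def by (metis UnI1)
    have ST: "finite (S \<union> T)" "S \<union> T \<subseteq> carrier G" using S T by auto
    obtain f d where f: "f \<in> {..<n} \<rightarrow> carrier G" and d: "d \<in> carrier G"
      "\<And>a. a \<in> F \<Longrightarrow> conj_by G a d = a"
      and fk: "\<And>i s. \<lbrakk>i < n; s \<in> S \<union> T\<rbrakk> \<Longrightarrow> conj_by G s (f i) = conj_by G s (k i)"
      and fd: "\<And>i s. \<lbrakk>i < n; s \<in> S \<union> T\<rbrakk> \<Longrightarrow>
        conj_by G (conj_by G s d) (f i) = conj_by G (conj_by G s (h i)) d"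
      \<comment> \<open>Here \<open>k\<close> is the tuple to be followed literally and
        \<open>h\<close> the one realized up to \<open>d\<close>.\<close>
      by (rule amalgamation[OF Age F ST g kG kg h hg]) auto
    have "\<forall>i<n. \<forall>s\<in>S. inner_tuple n f i (conj_by G s d) = conj_by G (conj_by G s (h i)) d"
      using fd S d(1) by (auto simp: inner_tuple_apply subset_iff)
    then have "absorbs n e (inner_tuple n f)" unfolding absorbs_def eq split using d by blast
    moreover have "\<forall>i<n. \<forall>x\<in>T. inner_tuple n f i x = \<alpha> i x"
      using fk k(2) T(2) by (auto simp: inner_tuple_apply agrees_with_inner_def subset_iff)
    ultimately show ?thesis using inner_tuple_in_auto[OF f] by blast
  qed
qed

text \<open>Any two rich tuples of automorphisms are conjugate, so the orbit of one of them contains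
  a countable intersection of dense open sets. Baire category serves only to find that one.\<close>

theorem has_ample_generic_automorphisms:
  assumes count: "countable (carrier G)" and Age: "Age_closed_times G \<or> Age_closed_times_Z G"
  shows "ample_generic_automorphisms G"
  unfolding ample_generic_automorphisms_def ample_generics_def
proof
  fix n
  let ?X = "auto_tuple_topology n" and ?E = "{..<n} \<rightarrow>\<^sub>E auto G"
  let ?\<D> = "(\<lambda>S. {\<alpha> \<in> ?E. locally_inner_on n S \<alpha>}) ` {S. finite S \<and> S \<subseteq> carrier G} \<union>
    (\<lambda>e. {\<alpha> \<in> ?E. absorbs n e \<alpha>}) ` inner_extensions n"
  have countD: "countable ?\<D>"
    using count countable_Collect_finite_subset[OF count] countable_inner_extensions[OF count]
    by (intro countable_Un countable_image)
  have D: "openin ?X D \<and> ?X closure_of D = topspace ?X" if "D \<in> ?\<D>" for D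
    using that
  proof (elim UnE imageE)
    fix S assume "S \<in> {S. finite S \<and> S \<subseteq> carrier G}" "D = {\<alpha> \<in> ?E. locally_inner_on n S \<alpha>}"
    then show ?thesis using openin_locally_inner_on[of S n] dense_locally_inner_on[of S n] by blast
  next
    fix e assume "e \<in> inner_extensions n" "D = {\<alpha> \<in> ?E. absorbs n e \<alpha>}"
    then show ?thesis using openin_absorbs[of e n] dense_absorbs[OF Age, of e n] by blast
  qed
  have rich: "\<alpha> \<in> ?E \<and> rich_tuple n \<alpha>" if \<alpha>: "\<alpha> \<in> \<Inter>?\<D>" for \<alpha>
  proof -
    have S: "\<alpha> \<in> {\<alpha> \<in> ?E. locally_inner_on n S \<alpha>}" if "finite S \<and> S \<subseteq> carrier G" for S
      by (rule InterD[OF \<alpha>], rule UnI1, rule imageI, rule CollectI, rule that)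
    have "\<alpha> \<in> {\<alpha> \<in> ?E. absorbs n e \<alpha>}" if "e \<in> inner_extensions n" for e
      by (rule InterD[OF \<alpha>], rule UnI2, rule imageI, rule that)
    \<comment> \<open>The empty set always gives a member of the family, which places
      \<open>\<alpha>\<close> in \<open>?E\<close>.\<close>
    then show ?thesis using S S[of "{}"] unfolding rich_tuple_def by simp
  qed
  have "completely_metrizable_space ?X"
    unfolding completely_metrizable_space_product_topology
    using completely_metrizable_space_pointwise_topology[OF count] by auto
  then have "?X closure_of \<Inter>?\<D> = topspace ?X"
    by (intro Baire_category[OF _ countD D] disjI1)
  moreover have "topspace ?X \<noteq> {}"
    using inner_tuple_in_auto[of "\<lambda>_. \<one>" n] unfolding topspace_auto_tuple_topology by auto
  ultimately have "\<Inter>?\<D> \<noteq> {}" using closure_of_empty[of ?X] by metis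
  then obtain \<alpha> where \<alpha>: "\<alpha> \<in> ?E" "rich_tuple n \<alpha>" using rich by blast
  have "comeagre_in ?X (diagonal_conj_orbit (AutoGroup G) n \<alpha>)"
  proof (rule comeagre_in_if_dense_open[OF countD D])
    show "diagonal_conj_orbit (AutoGroup G) n \<alpha> \<subseteq> topspace ?X"
      using \<alpha>(1) group.conj_by_closed[OF AutoGroup]
      by (auto simp: diagonal_conj_orbit_def topspace_pointwise_topology PiE_iff AutoGroup_def)
    show "topspace ?X \<inter> \<Inter>?\<D> \<subseteq> diagonal_conj_orbit (AutoGroup G) n \<alpha>"
    proof
      fix \<beta> assume "\<beta> \<in> topspace ?X \<inter> \<Inter>?\<D>"
      then have \<beta>: "\<beta> \<in> ?E" "rich_tuple n \<beta>" using rich[of \<beta>] by auto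
      obtain \<sigma> where "\<sigma> \<in> auto G" "\<And>i x. \<lbrakk>i < n; x \<in> carrier G\<rbrakk> \<Longrightarrow> \<sigma> (\<beta> i x) = \<alpha> i (\<sigma> x)"
        \<comment> \<open>With \<open>\<beta>\<close> first, the intertwiner has the direction that
          exhibits \<open>\<beta>\<close> as a conjugate of \<open>\<alpha>\<close>.\<close>
        using rich_tuples_conjugate[OF count \<beta>(2) \<alpha>(2)] PiE_mem[OF \<beta>(1)] by auto
      then show "\<beta> \<in> diagonal_conj_orbit (AutoGroup G) n \<alpha>"
        by (rule diagonal_conj_orbit_AutoGroup[OF \<alpha>(1) \<beta>(1)])
    qed
  qed
  then show "\<exists>g. generic_tuple (AutoGroup G) (pointwise_topology G) n g"
    using \<alpha>(1) unfolding generic_tuple_def by (intro exI[of _ \<alpha>]) (simp add: AutoGroup_def)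
qed

end

theorem theorem6p5:
  fixes \<Gamma> :: "'a monoid"
  assumes "group \<Gamma>"
    and "countable (carrier \<Gamma>)"
    and "inner_ultrahomogeneous \<Gamma>"
    and "Age_closed_times \<Gamma> \<or> Age_closed_times_Z \<Gamma>"
  shows "ample_generic_automorphisms \<Gamma>"
proof -
  interpret inner_ultrahomogeneous_group \<Gamma>
    using assms(1,3) by (intro inner_ultrahomogeneous_group.intro inner_ultrahomogeneous_group_axioms.intro)
  show ?thesis using assms(2,4) by (rule has_ample_generic_automorphisms)
qed

end
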